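(* Let $a>0$ be given and let $$V(x):=\sum_{n\ge0}e^{an}\,\mathbb{P}(T_n\le x),\qquad x\in\mathbb{R}.$$ Assume that either $a\in(0,R)$, or $a=R$ and $-\psi'(\gamma_0)=\mathbb{E}\,e^{-\gamma_0T}T>0$. Then, with $\gamma$ being the minimal $t>0$ satisfying $\psi(t)=e^{-a}$, $$V(x)\sim\frac{e^{-a}}{\gamma(-\psi'(\gamma))}\,e^{\gamma x}\qquad\text{as }x\to\infty$$ if $(T_n)_{n\ge0}$ is a non-arithmetic random walk, and $$V(\lambda n)\sim\frac{\lambda e^{-a}}{(1-e^{-\lambda\gamma})(-\psi'(\gamma))}\,e^{\gamma\lambda n}\qquad\text{as }n\to\infty\ (n\in\mathbb{N})$$ if $(T_n)_{n\ge0}$ is arithmetic with span $\lambda>0$. Moreover, in the arithmetic case, $$V(\lambda n)-V(\lambda(n-1))\sim\frac{\lambda e^{-a}}{-\psi'(\gamma)}\,e^{\gamma\lambda n}\qquad\text{as }n\to\infty\ (n\in\mathbb{N}).$$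
   Context: $T$ is a real-valued random variable (proper distribution) with $\mathbb{P}(T=0)\neq1$, and $(T_n)_{n\ge0}$ is a zero-delayed random walk with step distribution that of $T$, i.e. $T_0=0$ and $T_n$ is a sum of $n$ independent copies of $T$. Its Laplace transform is $\psi:[0,\infty)\to(0,\infty]$, $\psi(t):=\mathbb{E}e^{-tT}$, and $\psi'$ denotes the left derivative of $\psi$. Put $R:=-\log\inf_{t\ge0}\psi(t)\in[0,\infty]$. Unless $T\ge0$ a.s., the infimum is attained, and $\gamma_0\in[0,\infty)$ denotes the point with $\psi(\gamma_0)=e^{-R}$; a condition involving $\gamma_0$ presupposes that the infimum is attained. The random walk is arithmetic with span $\lambda>0$ if $\lambda$ is the largest number such that $\mathbb{P}(T\in\lambda\mathbb{Z})=1$, and non-arithmetic if $\mathbb{P}(T\in\lambda\mathbb{Z})<1$ for all $\lambda>0$. $f\sim g$ means $f/g\to1$. *)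

theory Defs
  imports "HOL-Probability.Probability" "HOL-Library.Landau_Symbols"
begin

definition zero_delayed_random_walk ::
    "'a measure \<Rightarrow> ('a \<Rightarrow> real) \<Rightarrow> (nat \<Rightarrow> 'a \<Rightarrow> real) \<Rightarrow> bool" where
  "zero_delayed_random_walk M T S \<longleftrightarrow>
     (\<exists>X. prob_space.indep_vars M (\<lambda>_. borel) X UNIV \<and>
          (\<forall>i. distr M borel (X i) = distr M borel T) \<and>
          (\<forall>n. \<forall>\<omega>\<in>space M. S n \<omega> = (\<Sum>i<n. X i \<omega>)))"

definition laplace :: "'a measure \<Rightarrow> ('a \<Rightarrow> real) \<Rightarrow> real \<Rightarrow> ennreal" where
  "laplace M T t = (\<integral>\<^sup>+\<omega>. ennreal (exp (- t * T \<omega>)) \<partial>M)"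

(* The left derivative at t > 0.  It is meaningful where the transform is finite at t, hence
   (by convexity) on all of [0, t]; there enn2real is the identity up to the type.  Elsewhere,
   enn2real sends the value infinity to 0. *)
definition laplace_left_deriv :: "'a measure \<Rightarrow> ('a \<Rightarrow> real) \<Rightarrow> real \<Rightarrow> real" where
  "laplace_left_deriv M T t = vector_derivative (\<lambda>s. enn2real (laplace M T s)) (at_left t)"

definition laplace_inf :: "'a measure \<Rightarrow> ('a \<Rightarrow> real) \<Rightarrow> ennreal" where
  "laplace_inf M T = (INF t\<in>{0..}. laplace M T t)"

(* R = - log (inf psi), with - log 0 = infinity; the infimum is at most psi 0 = 1. *)
definition laplace_R :: "'a measure \<Rightarrow> ('a \<Rightarrow> real) \<Rightarrow> ereal" where
  "laplace_R M T =
     (if laplace_inf M T = 0 then \<infinity> else ereal (- ln (enn2real (laplace_inf M T))))"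

definition lattice :: "real \<Rightarrow> real set" where
  "lattice d = range (\<lambda>k::int. d * of_int k)"

definition arithmetic_with_span :: "'a measure \<Rightarrow> ('a \<Rightarrow> real) \<Rightarrow> real \<Rightarrow> bool" where
  "arithmetic_with_span M T d \<longleftrightarrow>
     d > 0 \<and> measure M {\<omega>\<in>space M. T \<omega> \<in> lattice d} = 1 \<and>
     (\<forall>d'. measure M {\<omega>\<in>space M. T \<omega> \<in> lattice d'} = 1 \<longrightarrow> d' \<le> d)"

definition non_arithmetic :: "'a measure \<Rightarrow> ('a \<Rightarrow> real) \<Rightarrow> bool" where
  "non_arithmetic M T \<longleftrightarrow>
     (\<forall>d>0. measure M {\<omega>\<in>space M. T \<omega> \<in> lattice d} < 1)"

(* V(x) as a sum in [0, infinity], without presupposing convergence. *)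
definition renewal_V :: "'a measure \<Rightarrow> (nat \<Rightarrow> 'a \<Rightarrow> real) \<Rightarrow> real \<Rightarrow> real \<Rightarrow> ennreal" where
  "renewal_V M S a x =
     (\<Sum>n. ennreal (exp (a * real n) * measure M {\<omega>\<in>space M. S n \<omega> \<le> x}))"

end

theory Submission
  imports Defs
begin

text \<open>Let \<open>F\<close> be the law of \<open>T\<close> tilted by the density \<open>exp (a - \<gamma> t)\<close>. It is a probability measure
  with positive finite mean \<open>\<mu> = - exp a \<psi>' \<gamma>\<close>, and \<open>Q x = exp (- \<gamma> x) V x\<close> is the sum over \<open>n\<close> of the
  means of \<open>g (x - S\<^sub>n)\<close> for the walk \<open>S\<close> with step law \<open>F\<close>, where \<open>g z = exp (- \<gamma> z)\<close> for \<open>z \<ge> 0\<close>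
  and \<open>g z = 0\<close> otherwise. The claim is thus a two-sided renewal theorem.

  With \<open>G\<close> and \<open>J\<close> primitives of \<open>g\<close> and \<open>Q\<close>, telescoping and the weak law of large numbers give that
  the \<open>F\<close>-mean of \<open>J x - J (x - t)\<close> is \<open>G x\<close>, which tends to \<open>1 / \<gamma>\<close>. Every increment
  \<open>J x - J (x - y)\<close> solves a renewal equation, so by an argument in the style of Choquet and Deny it is
  asymptotically periodic with every period in the support of \<open>F\<close>, hence in the closed group
  generated by that support. So \<open>J x - J (x - y)\<close> becomes proportional to \<open>y\<close>, and the identity above
  determines the constant. Finally \<open>Q\<close> is recovered from the increments of \<open>J\<close>, since \<open>exp (\<gamma> x) Q x\<close> is
  monotone.\<close>

section \<open>Asymptotic periods of bounded solutions of a renewal equation\<close>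

text \<open>The weight \<open>exp (a - \<gamma> t)\<close> has mass one because \<psi> takes the
  value \<open>exp (- a)\<close> at \<gamma>, and at the minimal root \<psi> is decreasing, which
  makes the drift positive. Two obstacles shape the proof. Steps take both signs, so even the
  boundedness of \<open>Q\<close> is not automatic: truncated potentials have to be bounded first,
  uniformly in the truncation. And in the case \<open>a = R\<close> the tilted law may have no more
  than a first moment, so the law of large numbers is proved by characteristic functions, and
  integrals of increments of \<open>J\<close> are dominated by multiples of
  \<open>\<bar>t\<bar>\<close>. The primitive \<open>J\<close> enters because \<open>Q\<close> may
  jump while the period argument needs Lipschitz functions; \<open>J\<close> is unbounded in turn,
  so the argument is run on its increments. No limit is presupposed: once the increments are
  asymptotically proportional to their length, averaging them against \<open>F\<close> gives both
  the existence of the limit and its value.\<close>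

lemma filterlim_minus_const_at_top: "filterlim (\<lambda>x. x - t) at_top (at_top :: real filter)"
  by (rule filterlim_at_top_mono[OF filterlim_tendsto_add_at_top[OF tendsto_const[of "-t"] filterlim_ident]]) auto

text \<open>A maximum principle at infinity. If \<open>D x\<close> is nearly \<open>m\<close>, so is
  the mean of \<open>D (x - t)\<close>; since values above \<open>m\<close> become negligible, the
  mean deficit below \<open>m\<close> is small. A deficit at \<open>s\<close> would by the Lipschitz
  bound spread to a ball around \<open>s\<close>, which has positive mass.\<close>

lemma near_sup_shift:
  fixes D z :: "real \<Rightarrow> real"
  assumes "real_distribution F"
    and lip: "\<And>x y. \<bar>D x - D y\<bar> \<le> c * \<bar>x - y\<bar>"
    and bdd: "\<And>x. \<bar>D x\<bar> \<le> B"
    and eqn: "\<And>x. D x = z x + (\<integral>t. D (x - t) \<partial>F)"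
    and z: "(z \<longlongrightarrow> 0) at_top"
    and M: "\<And>e. e > 0 \<Longrightarrow> \<forall>\<^sub>F x in at_top. D x < m + e"
    and s: "\<And>d. d > 0 \<Longrightarrow> measure F (ball s d) > 0"
    and e: "e > 0"
  obtains e' where "e' > 0" "\<forall>\<^sub>F x in at_top. D x \<ge> m - e' \<longrightarrow> D (x - s) \<ge> m - e"
proof -
  interpret F: real_distribution F by fact
  have "\<bar>D 0 - D 1\<bar> \<le> c * \<bar>0 - 1\<bar>" by (rule lip)
  then have c: "c \<ge> 0" by simp
  have cont: "continuous_on UNIV D"
    by (rule lipschitz_on_continuous_on[of c], rule lipschitz_onI) (use lip c in \<open>auto simp: dist_real_def\<close>)
  have Dm[measurable]: "D \<in> borel_measurable borel"
    by (rule borel_measurable_continuous_onI[OF cont])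
  have intD: "integrable F (\<lambda>t. D (x - t))" for x
    by (rule F.integrable_const_bound[where B=B]) (use bdd in auto)
  \<comment> \<open>On a ball of this radius \<open>D\<close> varies by at most
    \<open>e / 2\<close>; adding 1 to \<open>c\<close> avoids division by zero.\<close>
  define d where "d = e / (2 * (c + 1))"
  have d: "d > 0" using e c by (auto simp: d_def)
  have cd: "c * d \<le> e / 2"
  proof -
    have "c * d \<le> (c + 1) * d" using d by simp
    also have "\<dots> = e / 2" using c by (simp add: d_def field_simps)
    finally show ?thesis .
  qed
  define p where "p = measure F (ball s d)"
  have p: "p > 0" using s[OF d] by (simp add: p_def)
  \<comment> \<open>A deficit of \<open>e / 2\<close> on the ball has mean \<open>p * e / 2\<close>,
    that is \<open>4 * e'\<close>, while the mean deficit will be below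
    \<open>3 * e'\<close>.\<close>
  define e' where "e' = p * e / 8"
  have e': "e' > 0" using p e by (simp add: e'_def)
  have B0: "B \<ge> 0" using bdd[of 0] by linarith
  have bnd1: "\<bar>max (D y - m) 0\<bar> \<le> B + \<bar>m\<bar>" and bnd2: "\<bar>max (m - D y) 0\<bar> \<le> B + \<bar>m\<bar>" for y
    using bdd[of y] B0 by linarith+
  have intP: "integrable F (\<lambda>t. max (D (x - t) - m) 0)" for x
    by (rule F.integrable_const_bound[where B="B + \<bar>m\<bar>"]) (use bnd1 in auto)
  have intN: "integrable F (\<lambda>t. max (m - D (x - t)) 0)" for x
    by (rule F.integrable_const_bound[where B="B + \<bar>m\<bar>"]) (use bnd2 in auto)
  \<comment> \<open>The mean excess over the asymptotic upper bound \<open>m\<close> vanishes by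
    dominated convergence.\<close>
  have "((\<lambda>x. \<integral>t. max (D (x - t) - m) 0 \<partial>F) \<longlongrightarrow> (\<integral>t. 0 \<partial>F)) at_top"
  proof (rule integral_dominated_convergence_at_top[where w="\<lambda>_. B + \<bar>m\<bar>"])
    show "AE t in F. ((\<lambda>x. max (D (x - t) - m) 0) \<longlongrightarrow> 0) at_top"
    proof (rule AE_I2)
      fix t
      show "((\<lambda>x. max (D (x - t) - m) 0) \<longlongrightarrow> 0) at_top"
      proof (rule tendstoI)
        fix r :: real assume r: "r > 0"
        from eventually_compose_filterlim[OF M[OF r] filterlim_minus_const_at_top[of t]]
        show "\<forall>\<^sub>F x in at_top. dist (max (D (x - t) - m) 0) 0 < r"
          by eventually_elim (use r in \<open>auto simp: dist_real_def max_def\<close>)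
      qed
    qed
    show "\<forall>\<^sub>F x in at_top. AE t in F. norm (max (D (x - t) - m) 0) \<le> B + \<bar>m\<bar>"
      using bnd1 by auto
  qed auto
  then have ev1: "\<forall>\<^sub>F x in at_top. (\<integral>t. max (D (x - t) - m) 0 \<partial>F) < e'"
    using e' by (simp add: order_tendstoD)
  have ev2: "\<forall>\<^sub>F x in at_top. z x < e'"
    using z e' by (simp add: order_tendstoD)
  have "\<forall>\<^sub>F x in at_top. D x \<ge> m - e' \<longrightarrow> D (x - s) \<ge> m - e"
    using ev1 ev2
  proof eventually_elim
    case (elim x)
    show ?case
    proof (intro impI, rule ccontr)
      assume D1: "m - e' \<le> D x" and D2: "\<not> m - e \<le> D (x - s)"
      have "(\<integral>t. max (m - D (x - t)) 0 \<partial>F)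
          = (\<integral>t. (m - D (x - t)) + max (D (x - t) - m) 0 \<partial>F)"
        by (rule Bochner_Integration.integral_cong) auto
      also have "\<dots> = (\<integral>t. m - D (x - t) \<partial>F) + (\<integral>t. max (D (x - t) - m) 0 \<partial>F)"
        using intD intP by (intro Bochner_Integration.integral_add) auto
      also have "(\<integral>t. m - D (x - t) \<partial>F) = m - (\<integral>t. D (x - t) \<partial>F)"
        using intD F.prob_space by (subst Bochner_Integration.integral_diff) auto
      \<comment> \<open>One \<open>e'\<close> each for the deficit of \<open>D x\<close>, the
        inhomogeneity \<open>z x\<close> and the mean excess.\<close>
      finally have up: "(\<integral>t. max (m - D (x - t)) 0 \<partial>F) < 3 * e'"
        using eqn[of x] elim D1 by linarith
      have "(\<integral>t. e / 2 * indicator (ball s d) t \<partial>F) \<le> (\<integral>t. max (m - D (x - t)) 0 \<partial>F)"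
      proof (rule integral_mono[OF _ intN])
        show "integrable F (\<lambda>t. e / 2 * indicator (ball s d) t)"
          by (rule F.integrable_const_bound[where B="e/2"]) (use e in \<open>auto simp: indicator_def\<close>)
        fix t
        show "e / 2 * indicator (ball s d) t \<le> max (m - D (x - t)) 0"
        proof (cases "t \<in> ball s d")
          case True
          then have "\<bar>s - t\<bar> \<le> d" by (simp add: dist_real_def)
          then have "c * \<bar>s - t\<bar> \<le> c * d" using c by (intro mult_left_mono)
          moreover have "\<bar>D (x - t) - D (x - s)\<bar> \<le> c * \<bar>s - t\<bar>"
            using lip[of "x - t" "x - s"] by simp
          ultimately have "D (x - t) \<le> m - e / 2" using D2 cd by linarith
          then have "e / 2 \<le> max (m - D (x - t)) 0" by linarith
          then show ?thesis using True by simp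
        qed simp
      qed
      moreover have "(\<integral>t. e / 2 * indicator (ball s d) t \<partial>F) = e / 2 * p"
        by (simp add: p_def)
      ultimately have "e / 2 * p < 3 * (p * e / 8)" using up unfolding e'_def by linarith
      moreover have "p * e > 0" using p e by simp
      ultimately show False by (simp add: field_simps)
    qed
  qed
  with e' show thesis by (rule that)
qed

text \<open>Each shift worsens the tolerance, so for a number \<open>N\<close> of shifts fixed
  beforehand the tolerances are chosen backwards from \<open>e\<close>. The induction performs one
  shift and then applies the hypothesis at \<open>x - s\<close>.\<close>

lemma near_sup_shifts:
  fixes D z :: "real \<Rightarrow> real"
  assumes "real_distribution F"
    and lip: "\<And>x y. \<bar>D x - D y\<bar> \<le> c * \<bar>x - y\<bar>"
    and bdd: "\<And>x. \<bar>D x\<bar> \<le> B"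
    and eqn: "\<And>x. D x = z x + (\<integral>t. D (x - t) \<partial>F)"
    and z: "(z \<longlongrightarrow> 0) at_top"
    and M: "\<And>e. e > 0 \<Longrightarrow> \<forall>\<^sub>F x in at_top. D x < m + e"
    and s: "\<And>d. d > 0 \<Longrightarrow> measure F (ball s d) > 0"
    and e: "e > 0"
  shows "\<exists>e'>0. \<forall>\<^sub>F x in at_top. D x \<ge> m - e' \<longrightarrow> (\<forall>k\<le>N. D (x - real k * s) \<ge> m - e)"
proof (induction N)
  case 0
  then show ?case using e by (intro exI[of _ e]) auto
next
  case (Suc N)
  then obtain e1 where e1: "e1 > 0"
    "\<forall>\<^sub>F x in at_top. D x \<ge> m - e1 \<longrightarrow> (\<forall>k\<le>N. D (x - real k * s) \<ge> m - e)" by blast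
  obtain e2 where e2: "e2 > 0" "\<forall>\<^sub>F x in at_top. D x \<ge> m - e2 \<longrightarrow> D (x - s) \<ge> m - e1"
    using near_sup_shift[OF assms(1-7) e1(1)] by blast
  have ev: "\<forall>\<^sub>F x in at_top. D (x - s) \<ge> m - e1 \<longrightarrow> (\<forall>k\<le>N. D ((x - s) - real k * s) \<ge> m - e)"
    using eventually_compose_filterlim[OF e1(2) filterlim_minus_const_at_top] .
  show ?case
  proof (intro exI[of _ "min e e2"] conjI)
    show "min e e2 > 0" using e e2 by simp
    show "\<forall>\<^sub>F x in at_top. m - min e e2 \<le> D x \<longrightarrow> (\<forall>k\<le>Suc N. m - e \<le> D (x - real k * s))"
      using ev e2(2)
    proof eventually_elim
      case (elim x)
      show ?case
      proof (intro impI allI)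
        fix k assume a: "m - min e e2 \<le> D x" "k \<le> Suc N"
        show "m - e \<le> D (x - real k * s)"
        proof (cases k)
          case 0 then show ?thesis using a by auto
        next
          case (Suc j)
          then show ?thesis using elim a by (auto simp: algebra_simps)
        qed
      qed
    qed
  qed
qed

text \<open>If the limit superior \<open>m\<close> of \<open>D x = H x - H (x - s)\<close> were positive, then, \<open>D\<close> being
  asymptotically its own \<open>F\<close>-average, a near-maximal value at \<open>x\<close> would force near-maximal values
  at \<open>x - s, x - 2 s, \<dots>\<close>; their sum telescopes, contradicting boundedness of \<open>H\<close>.\<close>

lemma period_limsup_le:
  fixes H z :: "real \<Rightarrow> real"
  assumes F: "real_distribution F"
    and lip: "\<And>x y. \<bar>H x - H y\<bar> \<le> c * \<bar>x - y\<bar>"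
    and bdd: "\<And>x. \<bar>H x\<bar> \<le> B"
    and eqn: "\<And>x. H x = z x + (\<integral>t. H (x - t) \<partial>F)"
    and z: "(z \<longlongrightarrow> 0) at_top"
    and s: "\<And>d. d > 0 \<Longrightarrow> measure F (ball s d) > 0"
    and e: "e > 0"
  shows "\<forall>\<^sub>F x in at_top. H x - H (x - s) < e"
proof -
  interpret F: real_distribution F by fact
  define D where "D x = H x - H (x - s)" for x
  have "\<bar>H 0 - H 1\<bar> \<le> c * \<bar>0 - 1\<bar>" by (rule lip)
  then have c: "c \<ge> 0" by simp
  have cont: "continuous_on UNIV H"
    by (rule lipschitz_on_continuous_on[of c], rule lipschitz_onI) (use lip c in \<open>auto simp: dist_real_def\<close>)
  have Hm[measurable]: "H \<in> borel_measurable borel"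
    by (rule borel_measurable_continuous_onI[OF cont])
  have intH: "integrable F (\<lambda>t. H (x - t))" for x
    by (rule F.integrable_const_bound[where B=B]) (use bdd in auto)
  have lipD: "\<bar>D x - D y\<bar> \<le> (2 * c) * \<bar>x - y\<bar>" for x y
    using lip[of x y] lip[of "x - s" "y - s"] unfolding D_def by simp
  have bddD: "\<bar>D x\<bar> \<le> 2 * B" for x
    using bdd[of x] bdd[of "x - s"] unfolding D_def by linarith
  have eqnD: "D x = (z x - z (x - s)) + (\<integral>t. D (x - t) \<partial>F)" for x
  proof -
    have "(\<integral>t. D (x - t) \<partial>F) = (\<integral>t. H (x - t) - H ((x - s) - t) \<partial>F)"
      by (simp add: D_def algebra_simps)
    also have "\<dots> = (\<integral>t. H (x - t) \<partial>F) - (\<integral>t. H ((x - s) - t) \<partial>F)"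
      using intH by (intro Bochner_Integration.integral_diff) auto
    finally show ?thesis using eqn[of x] eqn[of "x - s"] by (simp add: D_def)
  qed
  have "((\<lambda>x. z (x - s)) \<longlongrightarrow> 0) at_top"
    by (rule filterlim_compose[OF z filterlim_minus_const_at_top])
  from tendsto_diff[OF z this] have zD: "((\<lambda>x. z x - z (x - s)) \<longlongrightarrow> 0) at_top" by simp
  \<comment> \<open>The infimum of the eventual upper bounds is the limit superior, obtained as a
    real number.\<close>
  define E where "E = {q. \<forall>\<^sub>F x in at_top. D x \<le> q}"
  define m where "m = Inf E"
  have Ene: "2 * B \<in> E" using bddD unfolding E_def by (auto intro!: always_eventually) (smt (verit))
  have Ebd: "bdd_below E"
  proof (rule bdd_belowI[of _ "- 2 * B"])
    fix q assume "q \<in> E"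
    then have "\<forall>\<^sub>F x::real in at_top. D x \<le> q" by (simp add: E_def)
    then obtain x where "D x \<le> q" using eventually_happens by fastforce
    then show "- 2 * B \<le> q" using bddD[of x] by linarith
  qed
  have above: "\<forall>\<^sub>F x in at_top. D x < m + r" if r: "r > 0" for r
  proof -
    obtain q where "q \<in> E" "q < m + r"
      using cInf_lessD[of E "m + r"] Ene r unfolding m_def by auto
    then have "\<forall>\<^sub>F x in at_top. D x \<le> q" by (simp add: E_def)
    then show ?thesis by eventually_elim (use \<open>q < m + r\<close> in linarith)
  qed
  have "m \<le> 0"
  proof (rule ccontr)
    assume "\<not> m \<le> 0"
    then have m: "m > 0" by simp
    obtain N :: nat where N: "2 * B < real N * (m / 2)"
      using reals_Archimedean3[of "m/2"] m by (metis half_gt_zero)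
    obtain e' where e': "e' > 0"
      "\<forall>\<^sub>F x in at_top. D x \<ge> m - e' \<longrightarrow> (\<forall>k\<le>N. D (x - real k * s) \<ge> m - m / 2)"
      using near_sup_shifts[OF F lipD bddD eqnD zD above s, of "m/2" N] m by auto
    have "m - e' \<notin> E"
    proof
      assume "m - e' \<in> E"
      from cInf_lower[OF this Ebd] show False using e' by (simp add: m_def)
    qed
    then have "\<exists>\<^sub>F x in at_top. m - e' \<le> D x"
      unfolding E_def frequently_def by (auto simp: not_le intro: less_imp_le elim!: contrapos_nn eventually_mono)
    from eventually_happens'[OF trivial_limit_at_top_linorder] frequently_eventually_conj[OF this e'(2)]
    obtain x where x: "m - e' \<le> D x" "m - e' \<le> D x \<longrightarrow> (\<forall>k\<le>N. m - m / 2 \<le> D (x - real k * s))"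
      by (auto dest: frequently_ex)
    have "real N * (m / 2) = (\<Sum>k<N. m / 2)" by simp
    also have "\<dots> \<le> (\<Sum>k<N. D (x - real k * s))"
    proof (rule sum_mono)
      fix k assume "k \<in> {..<N}"
      then have "m - m / 2 \<le> D (x - real k * s)" using x by auto
      then show "m / 2 \<le> D (x - real k * s)" by simp
    qed
    also have "\<dots> = (\<Sum>k<N. H (x - real k * s) - H (x - real (Suc k) * s))"
      by (simp add: D_def algebra_simps)
    also have "\<dots> = H x - H (x - real N * s)"
      by (subst sum_lessThan_telescope') simp
    also have "\<dots> \<le> 2 * B" using bdd[of x] bdd[of "x - real N * s"] by linarith
    finally show False using N by simp
  qed
  with above[OF e] show ?thesis unfolding D_def
    by (auto elim!: eventually_mono)
qed

text \<open>The hypotheses are invariant under a change of sign of \<open>H\<close> and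
  \<open>z\<close>, so the one-sided bound applies to both signs.\<close>

lemma period_tendsto:
  fixes H z :: "real \<Rightarrow> real"
  assumes F: "real_distribution F"
    and lip: "\<And>x y. \<bar>H x - H y\<bar> \<le> c * \<bar>x - y\<bar>"
    and bdd: "\<And>x. \<bar>H x\<bar> \<le> B"
    and eqn: "\<And>x. H x = z x + (\<integral>t. H (x - t) \<partial>F)"
    and z: "(z \<longlongrightarrow> 0) at_top"
    and s: "\<And>d. d > 0 \<Longrightarrow> measure F (ball s d) > 0"
  shows "((\<lambda>x. H x - H (x - s)) \<longlongrightarrow> 0) at_top"
proof (rule tendstoI)
  fix e :: real assume e: "e > 0"
  have "\<forall>\<^sub>F x in at_top. H x - H (x - s) < e"
    by (rule period_limsup_le[OF assms e])
  moreover have "\<forall>\<^sub>F x in at_top. - H x - (- H (x - s)) < e"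
  proof (rule period_limsup_le[where H="\<lambda>x. - H x" and z="\<lambda>x. - z x" and c=c and B=B, OF F _ _ _ _ s e])
    show "\<bar>- H x - - H y\<bar> \<le> c * \<bar>x - y\<bar>" for x y using lip[of x y] by linarith
    show "- H x = - z x + (\<integral>t. - H (x - t) \<partial>F)" for x using eqn[of x] by simp
    show "((\<lambda>x. - z x) \<longlongrightarrow> 0) at_top" using tendsto_minus[OF z] by simp
  qed (use bdd in auto)
  ultimately show "\<forall>\<^sub>F x in at_top. dist (H x - H (x - s)) 0 < e"
    by eventually_elim (auto simp: dist_real_def)
qed

section \<open>Closed subgroups and the limit of increments\<close>

lemma subgroup_int_multiple:
  fixes A :: "real set"
  assumes "0 \<in> A" and diff: "\<And>x y. x \<in> A \<Longrightarrow> y \<in> A \<Longrightarrow> x - y \<in> A" and x: "x \<in> A"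
  shows "x * of_int k \<in> A"
proof (induction k rule: int_induct[where k=0])
  case base then show ?case using assms(1) by simp
next
  case (step1 i)
  have "x * of_int i - (0 - x) \<in> A" using diff assms(1) x step1 by blast
  then show ?case by (simp add: algebra_simps)
next
  case (step2 i)
  then show ?case using diff[OF step2(2) x] by (simp add: algebra_simps)
qed

text \<open>Arbitrarily small positive elements would have dense multiples and force the whole line;
  otherwise there is a least positive element and division with remainder applies. The value
  \<open>c = 0\<close> covers the trivial group.\<close>

lemma closed_subgroup_real:
  fixes A :: "real set"
  assumes cl: "closed A" and A0: "0 \<in> A"
    and diff: "\<And>x y. x \<in> A \<Longrightarrow> y \<in> A \<Longrightarrow> x - y \<in> A"
    and nt: "A \<noteq> UNIV"
  obtains c where "c \<ge> 0" "A = lattice c"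
proof -
  have mult: "x * of_int k \<in> A" if "x \<in> A" for x k
    using subgroup_int_multiple[OF A0 diff that] .
  have "\<exists>e>0. \<forall>x\<in>A. 0 < x \<longrightarrow> e \<le> x"
  proof (rule ccontr)
    assume *: "\<not> ?thesis"
    have "y \<in> closure A" for y
      unfolding closure_approachable
    proof safe
      fix e :: real assume "e > 0"
      with * obtain x where x: "x \<in> A" "0 < x" "x < e" by (auto simp: not_le)
      have "\<bar>x * of_int \<lfloor>y / x\<rfloor> - y\<bar> < x"
      proof -
        have "y / x - 1 < of_int \<lfloor>y / x\<rfloor>" "of_int \<lfloor>y / x\<rfloor> \<le> y / x" by linarith+
        then have "x * (y / x - 1) < x * of_int \<lfloor>y / x\<rfloor>" "x * of_int \<lfloor>y / x\<rfloor> \<le> x * (y / x)"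
          using x by (simp_all del: times_divide_eq_right)
        then show ?thesis using x by (simp add: algebra_simps)
      qed
      with x mult[OF x(1)] show "\<exists>z\<in>A. dist z y < e"
        by (intro bexI[of _ "x * of_int \<lfloor>y / x\<rfloor>"]) (auto simp: dist_real_def)
    qed
    with cl nt show False by auto
  qed
  then obtain e where e: "e > 0" "\<And>x. x \<in> A \<Longrightarrow> 0 < x \<Longrightarrow> e \<le> x" by blast
  show thesis
  proof (cases "\<exists>p\<in>A. p > 0")
    case False
    have "x = 0" if "x \<in> A" for x
      using False that diff[OF A0 that] by (metis diff_0 linorder_neqE_linordered_idom neg_0_less_iff_less)
    with A0 have "A = lattice 0" by (auto simp: lattice_def)
    then show ?thesis by (intro that[of 0]) auto
  next
    case True
    then obtain p where p: "p \<in> A" "p > 0" by blast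
    \<comment> \<open>Cutting off below \<open>e\<close> removes no positive element and keeps the
      set closed, so that the infimum is attained and positive.\<close>
    define c where "c = Inf (A \<inter> {e..})"
    have ne: "A \<inter> {e..} \<noteq> {}" using p e by auto
    have bd: "bdd_below (A \<inter> {e..})" by (rule bdd_belowI[of _ e]) auto
    have "c \<in> A \<inter> {e..}" unfolding c_def
      by (rule closed_contains_Inf[OF ne bd]) (use cl in auto)
    then have c: "c \<in> A" "c > 0" using e by auto
    have least: "c \<le> x" if "x \<in> A" "x > 0" for x
      unfolding c_def by (rule cInf_lower[OF _ bd]) (use e that in auto)
    have "x \<in> lattice c" if x: "x \<in> A" for x
    proof -
      let ?r = "x - c * of_int \<lfloor>x / c\<rfloor>"
      have r: "?r \<in> A" using diff[OF x mult[OF c(1)]] .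
      have "x / c - 1 < of_int \<lfloor>x / c\<rfloor>" "of_int \<lfloor>x / c\<rfloor> \<le> x / c" by linarith+
      then have "c * (x / c - 1) < c * of_int \<lfloor>x / c\<rfloor>" "c * of_int \<lfloor>x / c\<rfloor> \<le> c * (x / c)"
        using c by (simp_all del: times_divide_eq_right)
      then have "0 \<le> ?r" "?r < c" using c by (simp_all add: algebra_simps)
      with least[OF r] have "?r = 0" by linarith
      then show ?thesis by (auto simp: lattice_def)
    qed
    moreover have "lattice c \<subseteq> A" using mult[OF c(1)] by (auto simp: lattice_def)
    ultimately have "A = lattice c" by blast
    then show ?thesis using c by (intro that[of c]) auto
  qed
qed

lemma closed_lattice: "closed (lattice d)"
proof (cases "d = 0")
  case True
  then have "lattice d = {0}" by (auto simp: lattice_def)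
  then show ?thesis by simp
next
  case False
  have "lattice d = (\<lambda>x. x / d) -` \<int>"
    using False by (auto simp: lattice_def Ints_def field_simps)
  moreover have "closed ((\<lambda>x. x / d) -` \<int>)"
    by (intro closed_vimage closed_Ints continuous_intros) (use False in auto)
  ultimately show ?thesis by simp
qed

text \<open>Isolates what the period argument needs. The Lipschitz bound and the first moment of
  \<open>F\<close> make all integrals of increments finite although \<open>J\<close> itself may be
  unbounded.\<close>

locale renewal_identity = real_distribution F for F +
  fixes J G :: "real \<Rightarrow> real" and C L :: real
  assumes integrable_id: "integrable F (\<lambda>t. t)"
    and mean_pos: "(\<integral>t. t \<partial>F) > 0"
    and lip: "\<And>x y. \<bar>J x - J y\<bar> \<le> C * \<bar>x - y\<bar>"
    and identity: "\<And>x. (\<integral>t. J x - J (x - t) \<partial>F) = G x"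
    and G_lim: "(G \<longlongrightarrow> L) at_top"
begin

definition incr :: "real \<Rightarrow> real \<Rightarrow> real" where "incr y x = J x - J (x - y)"

text \<open>Quantifying over all \<open>y\<close> gives a single group of periods that serves every
  increment.\<close>

definition asymp_periods :: "real set" where
  "asymp_periods = {s. \<forall>y. ((\<lambda>x. incr y x - incr y (x - s)) \<longlongrightarrow> 0) at_top}"

lemma C_nonneg: "C \<ge> 0"
  using lip[of 0 1] by simp

lemma J_measurable [measurable]: "J \<in> borel_measurable borel"
  by (rule borel_measurable_continuous_onI, rule lipschitz_on_continuous_on[of C], rule lipschitz_onI)
    (use lip C_nonneg in \<open>auto simp: dist_real_def\<close>)

lemma integrable_J_diff: "integrable F (\<lambda>t. J x - J (x - t))"
proof (rule Bochner_Integration.integrable_bound)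
  show "integrable F (\<lambda>t. C * t)" using integrable_id by simp
  show "AE t in F. norm (J x - J (x - t)) \<le> norm (C * t)"
    using lip[of x "x - t" for t] C_nonneg by (auto simp: abs_mult)
qed simp

lemma incr_bound: "\<bar>incr y x\<bar> \<le> C * \<bar>y\<bar>"
  using lip[of x "x - y"] by (simp add: incr_def)

lemma incr_lip: "\<bar>incr y x - incr y x'\<bar> \<le> (2 * C) * \<bar>x - x'\<bar>"
  using lip[of x x'] lip[of "x - y" "x' - y"] by (simp add: incr_def)

lemma incr_lip_arg: "\<bar>incr y x - incr y' x\<bar> \<le> C * \<bar>y - y'\<bar>"
  using lip[of "x - y'" "x - y"] by (simp add: incr_def)

lemma incr_add: "incr (y + h) x = incr y x + incr h (x - y)"
  by (simp add: incr_def algebra_simps)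

text \<open>Taking the difference of \<open>identity\<close> at \<open>x\<close> and at
  \<open>x - y\<close> eliminates the unbounded \<open>J\<close>. The new inhomogeneity tends to 0
  because \<open>G\<close> has a limit.\<close>

lemma incr_renewal: "incr y x = (G x - G (x - y)) + (\<integral>t. incr y (x - t) \<partial>F)"
proof -
  have "(\<integral>t. incr y (x - t) \<partial>F)
      = (\<integral>t. (incr y x - (J x - J (x - t))) + (J (x - y) - J ((x - y) - t)) \<partial>F)"
    by (simp add: incr_def algebra_simps)
  also have "\<dots> = (\<integral>t. incr y x - (J x - J (x - t)) \<partial>F) + (\<integral>t. J (x - y) - J ((x - y) - t) \<partial>F)"
    by (intro Bochner_Integration.integral_add Bochner_Integration.integrable_diff integrable_J_diff) auto
  also have "(\<integral>t. incr y x - (J x - J (x - t)) \<partial>F) = (\<integral>t. incr y x \<partial>F) - (\<integral>t. J x - J (x - t) \<partial>F)"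
    by (intro Bochner_Integration.integral_diff integrable_J_diff) auto
  finally show ?thesis using prob_space by (simp add: identity)
qed

lemma support_in_asymp_periods:
  assumes s: "\<And>d. d > 0 \<Longrightarrow> measure F (ball s d) > 0"
  shows "s \<in> asymp_periods"
  unfolding asymp_periods_def
proof safe
  fix y
  have "((\<lambda>x. G (x - y)) \<longlongrightarrow> L) at_top"
    by (rule filterlim_compose[OF G_lim filterlim_minus_const_at_top])
  from tendsto_diff[OF G_lim this] have z: "((\<lambda>x. G x - G (x - y)) \<longlongrightarrow> 0) at_top" by simp
  show "((\<lambda>x. incr y x - incr y (x - s)) \<longlongrightarrow> 0) at_top"
    by (rule period_tendsto[OF real_distribution_axioms incr_lip incr_bound incr_renewal z s])
qed

text \<open>All increments share the Lipschitz constant \<open>2 * C\<close>, so replacing a shift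
  by a nearby one costs little, uniformly in \<open>x\<close>.\<close>

lemma closed_asymp_periods: "closed asymp_periods"
proof -
  have "s \<in> asymp_periods" if s: "s \<in> closure asymp_periods" for s
    unfolding asymp_periods_def
  proof safe
    fix y
    show "((\<lambda>x. incr y x - incr y (x - s)) \<longlongrightarrow> 0) at_top"
    proof (rule tendstoI)
      fix e :: real assume e: "e > 0"
      define d where "d = e / (4 * (C + 1))"
      have d: "d > 0" using e C_nonneg by (simp add: d_def)
      obtain s' where s': "s' \<in> asymp_periods" "dist s' s < d"
        using s d unfolding closure_approachable by blast
      have "2 * C * \<bar>s' - s\<bar> \<le> 2 * (C + 1) * d"
        using s' C_nonneg by (intro mult_mono) (auto simp: dist_real_def)
      also have "\<dots> = e / 2" using C_nonneg by (simp add: d_def field_simps)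
      finally have le: "2 * C * \<bar>s' - s\<bar> \<le> e / 2" .
      have "\<forall>\<^sub>F x in at_top. \<bar>incr y x - incr y (x - s')\<bar> < e / 2"
        using s'(1) tendstoD[of "\<lambda>x. incr y x - incr y (x - s')" 0 at_top "e/2"] e
        by (simp add: asymp_periods_def dist_real_def)
      then show "\<forall>\<^sub>F x in at_top. dist (incr y x - incr y (x - s)) 0 < e"
      proof eventually_elim
        case (elim x)
        then show ?case
          using incr_lip[of y "x - s'" "x - s"] le unfolding dist_real_def by (simp add: abs_minus_commute[of s s']) argo
      qed
    qed
  qed
  then show ?thesis by (metis closure_subset closure_eq subsetI subset_antisym)
qed

lemma zero_in_asymp_periods: "0 \<in> asymp_periods" by (simp add: asymp_periods_def)

lemma diff_in_asymp_periods:
  assumes "s \<in> asymp_periods" "t \<in> asymp_periods" shows "s - t \<in> asymp_periods"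
  unfolding asymp_periods_def
proof safe
  fix y
  have 1: "((\<lambda>x. incr y x - incr y (x - s)) \<longlongrightarrow> 0) at_top" using assms by (simp add: asymp_periods_def)
  have "((\<lambda>x. incr y x - incr y (x - t)) \<longlongrightarrow> 0) at_top" using assms by (simp add: asymp_periods_def)
  \<comment> \<open>Started at \<open>x - (s - t)\<close>, a shift by \<open>t\<close> ends at
    \<open>x - s\<close>.\<close>
  from filterlim_compose[OF this filterlim_minus_const_at_top[of "s - t"]]
  have 2: "((\<lambda>x. incr y (x - (s - t)) - incr y (x - s)) \<longlongrightarrow> 0) at_top" by simp
  from tendsto_diff[OF 1 2]
  show "((\<lambda>x. incr y x - incr y (x - (s - t))) \<longlongrightarrow> 0) at_top" by simp
qed

text \<open>The complement of the support is a union of open null sets, and by Lindelof countably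
  many of them suffice, so it is null.\<close>

lemma AE_in_asymp_periods: "AE t in F. t \<in> asymp_periods"
proof -
  define B where "B = {S. open S \<and> measure F S = 0}"
  obtain B' where B': "B' \<subseteq> B" "countable B'" "\<Union>B' = \<Union>B"
    using Lindelof[of B] by (auto simp: B_def)
  have "AE t in F. \<forall>S\<in>B'. t \<notin> S"
  proof (subst AE_ball_countable[OF B'(2)], intro ballI)
    fix S assume "S \<in> B'"
    then have "open S" "measure F S = 0" using B'(1) by (auto simp: B_def)
    then have "S \<in> null_sets F" by (intro null_setsI) (auto simp: emeasure_eq_measure)
    then show "AE t in F. t \<notin> S" by (rule AE_not_in)
  qed
  then show ?thesis
  proof eventually_elim
    case (elim t)
    show ?case
    proof (rule support_in_asymp_periods, rule ccontr)
      fix d :: real assume "d > 0" "\<not> measure F (ball t d) > 0"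
      then have "ball t d \<in> B" by (auto simp: B_def zero_less_measure_iff measure_le_0_iff)
      moreover have "t \<in> ball t d" using \<open>d > 0\<close> by simp
      ultimately have "t \<in> \<Union>B" by blast
      with elim B'(3) show False by auto
    qed
  qed
qed

text \<open>A proper closed group of periods would be a lattice carrying all the mass of
  \<open>F\<close>.\<close>

lemma asymp_periods_non_arithmetic:
  assumes na: "\<And>d. d > 0 \<Longrightarrow> measure F (lattice d) < 1"
  shows "asymp_periods = UNIV"
proof (rule ccontr)
  assume "asymp_periods \<noteq> UNIV"
  then obtain c where c: "c \<ge> 0" "asymp_periods = lattice c"
    using closed_subgroup_real[OF closed_asymp_periods zero_in_asymp_periods diff_in_asymp_periods] by blast
  have m: "measure F (lattice c') = 1" if "lattice c \<subseteq> lattice c'" for c'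
    by (rule prob_eq_1[THEN iffD2]) (use closed_lattice AE_in_asymp_periods c that in auto)
  \<comment> \<open>If \<open>c = 0\<close>, the mass sits at 0, and the lattice of span 1 gives a
    contradiction with positive span.\<close>
  have "lattice 0 \<subseteq> lattice 1" by (auto simp: lattice_def intro: range_eqI[of _ _ 0])
  with m[of 1] m[of c] na[of 1] na[of c] c show False by (cases "c = 0") auto
qed

text \<open>The group of periods may be the whole line, so it is first cut down to
  \<open>lattice d\<close>. The result is a lattice of span \<open>c\<close> carrying
  \<open>F\<close>; \<open>c\<close> is a multiple of \<open>d\<close>, nonzero because the mean is,
  and at most \<open>d\<close> by maximality.\<close>

lemma span_in_asymp_periods:
  assumes d: "d > 0" and md: "measure F (lattice d) = 1"
    and mx: "\<And>d'. measure F (lattice d') = 1 \<Longrightarrow> d' \<le> d"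
  shows "d \<in> asymp_periods"
proof -
  let ?A = "asymp_periods \<inter> lattice d"
  have "AE t in F. t \<in> lattice d"
    using prob_eq_1[of "lattice d"] md closed_lattice by auto
  with AE_in_asymp_periods have AE: "AE t in F. t \<in> ?A" by eventually_elim auto
  have ne: "?A \<noteq> UNIV"
  proof
    assume "?A = UNIV"
    then have "d / 2 \<in> lattice d" by auto
    then obtain k :: int where "d / 2 = d * of_int k" by (auto simp: lattice_def)
    then have "(2 * of_int k :: real) = 1" using d by (simp add: field_simps)
    then have "real_of_int (2 * k) = real_of_int 1" by simp
    then have "2 * k = 1" by (simp only: of_int_eq_iff)
    then show False by presburger
  qed
  have df: "x - y \<in> lattice d" if "x \<in> lattice d" "y \<in> lattice d" for x y
  proof -
    from that obtain i j :: int where "x = d * of_int i" "y = d * of_int j" by (auto simp: lattice_def)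
    then have "x - y = d * of_int (i - j)" by (simp add: algebra_simps)
    then show ?thesis unfolding lattice_def by blast
  qed
  have "0 \<in> lattice d" unfolding lattice_def by (rule range_eqI[of _ _ 0]) simp
  then obtain c where c: "c \<ge> 0" "?A = lattice c"
    using closed_subgroup_real[OF closed_Int[OF closed_asymp_periods closed_lattice[of d]] _ _ ne]
      zero_in_asymp_periods diff_in_asymp_periods df by (metis IntD1 IntD2 IntI)
  have "c \<noteq> 0"
  proof
    assume "c = 0"
    then have "AE t in F. t = 0" using AE c(2) by (auto simp: lattice_def)
    then have "(\<integral>t. t \<partial>F) = (\<integral>t. 0 \<partial>F)" by (intro integral_cong_AE) auto
    with mean_pos show False by simp
  qed
  have "measure F (lattice c) = 1"
    by (rule prob_eq_1[THEN iffD2]) (use closed_lattice AE c in auto)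
  then have "c \<le> d" by (rule mx)
  have "c \<in> lattice c" unfolding lattice_def by (rule range_eqI[of _ _ 1]) simp
  then have cA: "c \<in> ?A" using c by simp
  then obtain k :: int where k: "c = d * of_int k" by (auto simp: lattice_def)
  with \<open>c \<noteq> 0\<close> c(1) d have "k \<ge> 1" by (auto simp: zero_le_mult_iff)
  then have "d * 1 \<le> d * of_int k" using d by (intro mult_left_mono) auto
  with k \<open>c \<le> d\<close> have "c = d" by simp
  with cA show ?thesis by simp
qed

text \<open>An increment over several steps of length \<open>h\<close> splits into increments over
  \<open>h\<close> at points shifted by multiples of \<open>h\<close>, and these multiples are again
  periods.\<close>

lemma incr_multiple:
  assumes h: "h \<in> asymp_periods"
  shows "((\<lambda>x. incr (h * of_int k) x - of_int k * incr h x) \<longlongrightarrow> 0) at_top"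
proof -
  have P: "((\<lambda>x. incr h x - incr h (x - h * of_int i)) \<longlongrightarrow> 0) at_top" for i :: int
    using subgroup_int_multiple[OF zero_in_asymp_periods diff_in_asymp_periods h] by (simp add: asymp_periods_def)
  show ?thesis
  proof (induction k rule: int_induct[where k=0])
    case base then show ?case by (simp add: incr_def)
  next
    case (step1 i)
    from tendsto_diff[OF step1(2) P[of i]]
    show ?case using incr_add[of "h * of_int i" h] by (simp add: algebra_simps)
  next
    case (step2 i)
    from tendsto_add[OF step2(2) P[of "i - 1"]]
    show ?case using incr_add[of "h * of_int (i - 1)" h] by (simp add: algebra_simps)
  qed
qed

text \<open>Commensurability up to a bounded error: \<open>n * y\<close> differs from a multiple
  \<open>h * k\<close> by less than \<open>h\<close>. The resulting error is bounded independently
  of \<open>n\<close> and disappears after division by \<open>n\<close>.\<close>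

lemma incr_proportional:
  assumes P: "asymp_periods = UNIV" and h: "h > 0"
  shows "((\<lambda>x. incr y x - y / h * incr h x) \<longlongrightarrow> 0) at_top"
proof (rule tendstoI)
  fix e :: real assume e: "e > 0"
  \<comment> \<open>Two errors of size \<open>C * h\<close> then stay below \<open>n * e / 2\<close>
    in total; the two errors of size \<open>e / 8\<close> fit into the rest.\<close>
  obtain n0 :: nat where n0: "4 * C * h / e < real n0" using reals_Archimedean2 by blast
  define n where "n = Suc n0"
  have n: "n > 0" "4 * C * h < e * real n"
    using n0 e by (auto simp: n_def field_simps)
  define k where "k = \<lfloor>real n * y / h\<rfloor>"
  have "of_int k \<le> real n * y / h" "real n * y / h < of_int k + 1" unfolding k_def by linarith+
  then have k: "h * of_int k \<le> real n * y" "real n * y < h * of_int k + h"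
    using h by (simp_all add: field_simps)
  have "\<forall>\<^sub>F x in at_top. \<bar>incr (y * of_int (int n)) x - of_int (int n) * incr y x\<bar> < e / 8"
    using tendstoD[OF incr_multiple[of y "int n"], of "e/8"] P e by (simp add: dist_real_def)
  moreover have "\<forall>\<^sub>F x in at_top. \<bar>incr (h * of_int k) x - of_int k * incr h x\<bar> < e / 8"
    using tendstoD[OF incr_multiple[of h k], of "e/8"] P e by (simp add: dist_real_def)
  ultimately show "\<forall>\<^sub>F x in at_top. dist (incr y x - y / h * incr h x) 0 < e"
  proof eventually_elim
    case (elim x)
    have 1: "\<bar>incr (y * real n) x - incr (h * of_int k) x\<bar> \<le> C * h"
    proof -
      have "\<bar>incr (y * real n) x - incr (h * of_int k) x\<bar> \<le> C * \<bar>y * real n - h * of_int k\<bar>"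
        by (rule incr_lip_arg)
      also have "\<dots> \<le> C * h" using k C_nonneg h by (intro mult_left_mono) (auto simp: mult.commute)
      finally show ?thesis .
    qed
    have 2: "\<bar>of_int k * incr h x - real n * y / h * incr h x\<bar> \<le> C * h"
    proof -
      have "\<bar>of_int k * incr h x - real n * y / h * incr h x\<bar> = \<bar>of_int k - real n * y / h\<bar> * \<bar>incr h x\<bar>"
        by (simp add: abs_mult[symmetric] left_diff_distrib)
      also have "\<dots> \<le> 1 * (C * \<bar>h\<bar>)"
        by (intro mult_mono incr_bound) (unfold k_def, linarith, auto)
      finally show ?thesis using h by simp
    qed
    have "\<bar>real n * incr y x - real n * y / h * incr h x\<bar> < real n * e"
    proof -
      have "e * 1 \<le> e * real n" using n(1) e by (intro mult_left_mono) auto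
      with elim 1 2 n(2) show ?thesis unfolding of_int_of_nat_eq mult.commute[of e] mult.assoc by linarith
    qed
    also have "real n * incr y x - real n * y / h * incr h x = real n * (incr y x - y / h * incr h x)"
      by (simp add: algebra_simps)
    finally have "real n * \<bar>incr y x - y / h * incr h x\<bar> < real n * e" by (simp add: abs_mult)
    then show ?case using n(1) by (simp add: dist_real_def)
  qed
qed

text \<open>Integrating the proportionality over \<open>y\<close> against \<open>F\<close> turns
  \<open>incr y x\<close> into \<open>G x\<close> by \<open>identity\<close> and \<open>y\<close>
  into the mean. Validity for almost every \<open>y\<close> is enough, so the lattice case is
  included.\<close>

lemma incr_limit_aux:
  assumes h: "h > 0" and AE: "AE y in F. ((\<lambda>x. incr y x - y / h * incr h x) \<longlongrightarrow> 0) at_top"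
  shows "(incr h \<longlongrightarrow> h * L / (\<integral>t. t \<partial>F)) at_top"
proof -
  let ?m = "\<integral>t. t \<partial>F"
  have "((\<lambda>x. \<integral>y. incr y x - y / h * incr h x \<partial>F) \<longlongrightarrow> (\<integral>y. 0 \<partial>F)) at_top"
  proof (rule integral_dominated_convergence_at_top[where w="\<lambda>y. 2 * C * \<bar>y\<bar>"])
    show "\<forall>\<^sub>F x in at_top. AE y in F. norm (incr y x - y / h * incr h x) \<le> 2 * C * \<bar>y\<bar>"
    proof (intro always_eventually allI AE_I2)
      fix x y
      have "\<bar>y / h * incr h x\<bar> = \<bar>y\<bar> / h * \<bar>incr h x\<bar>" using h by (simp add: abs_mult)
      also have "\<dots> \<le> \<bar>y\<bar> / h * (C * \<bar>h\<bar>)"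
        using h incr_bound[of h x] by (intro mult_left_mono) auto
      finally have "\<bar>y / h * incr h x\<bar> \<le> \<bar>y\<bar> / h * (C * \<bar>h\<bar>)" .
      then have "\<bar>y / h * incr h x\<bar> \<le> C * \<bar>y\<bar>" using h by (simp add: mult.commute)
      from order_trans[OF abs_triangle_ineq4 add_mono[OF incr_bound[of y x] this]]
      show "norm (incr y x - y / h * incr h x) \<le> 2 * C * \<bar>y\<bar>" by simp
    qed
    show "integrable F (\<lambda>y. 2 * C * \<bar>y\<bar>)" using integrable_id by simp
  qed (use AE in \<open>auto simp: incr_def\<close>)
  moreover have "(\<integral>y. incr y x - y / h * incr h x \<partial>F) = G x - ?m / h * incr h x" for x
  proof -
    have "(\<integral>y. incr y x - y / h * incr h x \<partial>F) = (\<integral>y. incr y x \<partial>F) - (\<integral>y. y / h * incr h x \<partial>F)"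
      using integrable_J_diff integrable_id by (intro Bochner_Integration.integral_diff) (auto simp: incr_def)
    then show ?thesis by (simp add: identity incr_def)
  qed
  ultimately have "((\<lambda>x. G x - ?m / h * incr h x) \<longlongrightarrow> 0) at_top" by simp
  from tendsto_diff[OF G_lim this] have "((\<lambda>x. ?m / h * incr h x) \<longlongrightarrow> L) at_top" by simp
  from tendsto_mult[OF tendsto_const[of "h / ?m"] this] show ?thesis
    using h mean_pos by simp
qed

theorem incr_limit_non_arithmetic:
  assumes "\<And>d. d > 0 \<Longrightarrow> measure F (lattice d) < 1" and "h > 0"
  shows "((\<lambda>x. J x - J (x - h)) \<longlongrightarrow> h * L / (\<integral>t. t \<partial>F)) at_top"
  using incr_limit_aux[OF assms(2)] incr_proportional[OF asymp_periods_non_arithmetic[OF assms(1)] assms(2)]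
  by (simp add: incr_def[abs_def])

theorem incr_limit_arithmetic:
  assumes d: "d > 0" and md: "measure F (lattice d) = 1"
    and mx: "\<And>d'. measure F (lattice d') = 1 \<Longrightarrow> d' \<le> d"
  shows "((\<lambda>x. J x - J (x - d)) \<longlongrightarrow> d * L / (\<integral>t. t \<partial>F)) at_top"
proof -
  have "AE y in F. y \<in> lattice d"
    using prob_eq_1[of "lattice d"] md closed_lattice by auto
  then have "AE y in F. ((\<lambda>x. incr y x - y / d * incr d x) \<longlongrightarrow> 0) at_top"
  proof eventually_elim
    case (elim y)
    then obtain k :: int where "y = d * of_int k" by (auto simp: lattice_def)
    with incr_multiple[OF span_in_asymp_periods[OF assms], of k] d show ?case by simp
  qed
  from incr_limit_aux[OF d this] show ?thesis by (simp add: incr_def[abs_def])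
qed

end

section \<open>Convolution powers and the weak law of large numbers\<close>

lemma cmod_iexp_diff_le: "cmod (iexp a - iexp b) \<le> \<bar>a - b\<bar>"
proof -
  have "iexp a - iexp b = iexp b * (iexp (a - b) - 1)"
    by (simp add: right_diff_distrib exp_add[symmetric])
  then have "cmod (iexp a - iexp b) = cmod (iexp (a - b) - 1)"
    by (simp add: norm_mult)
  also have "\<dots> \<le> \<bar>a - b\<bar>" using iexp_approx1[of "a - b" 0] by simp
  finally show ?thesis .
qed

lemma iexp_scaled_limit: "(\<lambda>n. of_nat n * (iexp (u / real n) - 1)) \<longlonglongrightarrow> \<i> * complex_of_real u"
proof -
  have "(\<lambda>n. of_nat n * (iexp (u / real n) - 1) - \<i> * complex_of_real u) \<longlonglongrightarrow> 0"
  proof (rule Lim_null_comparison)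
    show "\<forall>\<^sub>F n in sequentially. norm (of_nat n * (iexp (u / real n) - 1) - \<i> * complex_of_real u) \<le> u\<^sup>2 / real n"
      using eventually_gt_at_top[of 0]
    proof eventually_elim
      case (elim n)
      have "of_nat n * (iexp (u / real n) - 1) - \<i> * complex_of_real u
          = of_nat n * (iexp (u / real n) - (1 + \<i> * complex_of_real (u / real n)))"
        using elim by (simp add: field_simps)
      also have "cmod \<dots> = real n * cmod (iexp (u / real n) - (1 + \<i> * complex_of_real (u / real n)))"
        by (simp only: norm_mult norm_of_nat)
      also have "\<dots> \<le> real n * ((u / real n)\<^sup>2)"
      proof (rule mult_left_mono)
        have "cmod (iexp (u / real n) - (1 + \<i> * complex_of_real (u / real n))) \<le> (u / real n)\<^sup>2 / 2"
          using iexp_approx1[of "u / real n" 1] by (simp add: numeral_2_eq_2)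
        also have "\<dots> \<le> (u / real n)\<^sup>2" by simp
        finally show "cmod (iexp (u / real n) - (1 + \<i> * complex_of_real (u / real n))) \<le> (u / real n)\<^sup>2" .
      qed simp
      also have "\<dots> = u\<^sup>2 / real n" using elim by (simp add: field_simps power2_eq_square)
      finally show ?case .
    qed
    show "(\<lambda>n. u\<^sup>2 / real n) \<longlonglongrightarrow> 0" by (rule lim_const_over_n)
  qed
  then show ?thesis by (simp add: LIM_zero_iff)
qed

text \<open>This is the law of the walk after \<open>n\<close> steps. The new factor stands on the
  left, so the recursion conditions on the first step.\<close>

primrec conv_power :: "real measure \<Rightarrow> nat \<Rightarrow> real measure" where
  "conv_power F 0 = return borel 0"
| "conv_power F (Suc n) = convolution F (conv_power F n)"

context real_distribution
begin

lemma real_distribution_conv_power: "real_distribution (conv_power M n)"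
proof (induction n)
  case 0
  show ?case by (auto simp: real_distribution_def real_distribution_axioms_def intro!: prob_space_return)
next
  case (Suc n)
  then interpret N: real_distribution "conv_power M n" .
  interpret P: pair_prob_space M "conv_power M n" ..
  show ?case unfolding conv_power.simps convolution_def
    by (auto simp: real_distribution_def real_distribution_axioms_def intro!: P.prob_space_distr)
qed

lemma conv_power_events [simp, measurable_cong]: "sets (conv_power M n) = sets borel"
  using real_distribution_conv_power by (rule real_distribution.events_eq_borel)

lemma integral_conv_power_Suc:
  fixes f :: "real \<Rightarrow> 'b::{banach, second_countable_topology}"
  assumes [measurable]: "f \<in> borel_measurable borel" and bdd: "\<And>x. norm (f x) \<le> B"
  shows "(\<integral>x. f x \<partial>conv_power M (Suc n)) = (\<integral>t. \<integral>s. f (t + s) \<partial>conv_power M n \<partial>M)"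
proof -
  interpret N: real_distribution "conv_power M n" by (rule real_distribution_conv_power)
  interpret P: pair_prob_space M "conv_power M n" ..
  have "(\<integral>x. f x \<partial>conv_power M (Suc n)) = (\<integral>p. f (case p of (x, y) \<Rightarrow> x + y) \<partial>(M \<Otimes>\<^sub>M conv_power M n))"
    by (simp add: convolution_def integral_distr)
  also have "\<dots> = (\<integral>p. (case p of (x, y) \<Rightarrow> f (x + y)) \<partial>(M \<Otimes>\<^sub>M conv_power M n))"
    by (simp add: case_prod_beta)
  also have "\<dots> = (\<integral>t. \<integral>s. f (t + s) \<partial>conv_power M n \<partial>M)"
  proof (rule P.integral_fst'[symmetric, where f="\<lambda>(x, y). f (x + y)", simplified])
    show "integrable (M \<Otimes>\<^sub>M conv_power M n) (\<lambda>(x, y). f (x + y))"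
      by (rule P.integrable_const_bound[where B=B]) (use bdd in auto)
  qed
  finally show ?thesis .
qed

lemma char_conv_power: "char (conv_power M n) t = char M t ^ n"
proof (induction n)
  case 0 show ?case by (simp add: char_def integral_return)
next
  case (Suc n)
  have "char (conv_power M (Suc n)) t = (CLINT x|M. CLINT s|conv_power M n. iexp (t * (x + s)))"
    unfolding char_def by (rule integral_conv_power_Suc[where B=1]) auto
  also have "\<dots> = (CLINT x|M. iexp (t * x) * char (conv_power M n) t)"
    unfolding char_def by (simp add: distrib_left exp_add)
  also have "\<dots> = char M t * char (conv_power M n) t" by (simp add: char_def)
  finally show ?case using Suc by simp
qed

text \<open>Without a variance, the weak law is derived from Levy continuity: the laws of
  \<open>s / n\<close> converge weakly to the point mass at the mean \<open>m\<close>, while a fixed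
  \<open>x\<close> eventually falls below \<open>m / 2 * n\<close>.\<close>

lemma conv_power_tends_to_infinity:
  assumes int: "integrable M (\<lambda>x. x)" and pos: "(\<integral>x. x \<partial>M) > 0"
  shows "(\<lambda>n. measure (conv_power M n) {..x}) \<longlonglongrightarrow> 0"
proof -
  define m where "m = (\<integral>x. x \<partial>M)"
  have m: "m > 0" using pos by (simp add: m_def)
  define N where "N n = distr (conv_power M n) borel (\<lambda>s. s / real n)" for n
  have rN: "real_distribution (N n)" for n
  proof -
    interpret C: real_distribution "conv_power M n" by (rule real_distribution_conv_power)
    show ?thesis unfolding N_def by (rule C.real_distribution_distr) simp
  qed
  have rR: "real_distribution (return borel m)"
    by (auto simp: real_distribution_def real_distribution_axioms_def intro!: prob_space_return)
  have charN: "char (N n) t = char M (t / real n) ^ n" for n t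
  proof -
    have "char (N n) t = char (conv_power M n) (t / real n)"
      unfolding char_def N_def by (subst integral_distr) auto
    then show ?thesis by (simp add: char_conv_power)
  qed
  have conv: "(\<lambda>n. char (N n) t) \<longlonglongrightarrow> char (return borel m) t" for t
  proof -
    \<comment> \<open>First-order expansion under the integral: the limit is linear in
      \<open>x - m\<close> and has mean 0, with majorant
      \<open>\<bar>t\<bar> * \<bar>x - m\<bar>\<close>.\<close>
    have "(\<lambda>n. \<integral>x. of_nat n * (iexp (t / real n * x) - iexp (t / real n * m)) \<partial>M)
        \<longlonglongrightarrow> (\<integral>x. \<i> * complex_of_real (t * x) - \<i> * complex_of_real (t * m) \<partial>M)"
    proof (rule integral_dominated_convergence[where w="\<lambda>x. \<bar>t\<bar> * \<bar>x - m\<bar>"])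
      show "integrable M (\<lambda>x. \<bar>t\<bar> * \<bar>x - m\<bar>)" using int by auto
      show "AE x in M. (\<lambda>n. of_nat n * (iexp (t / real n * x) - iexp (t / real n * m)))
          \<longlonglongrightarrow> \<i> * complex_of_real (t * x) - \<i> * complex_of_real (t * m)"
      proof (rule AE_I2)
        fix x
        show "(\<lambda>n. of_nat n * (iexp (t / real n * x) - iexp (t / real n * m)))
          \<longlonglongrightarrow> \<i> * complex_of_real (t * x) - \<i> * complex_of_real (t * m)"
          using tendsto_diff[OF iexp_scaled_limit[of "t * x"] iexp_scaled_limit[of "t * m"]]
          by (simp add: algebra_simps)
      qed
      show "AE x in M. norm (of_nat n * (iexp (t / real n * x) - iexp (t / real n * m))) \<le> \<bar>t\<bar> * \<bar>x - m\<bar>" for n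
      proof (rule AE_I2)
        fix x
        have "norm (of_nat n * (iexp (t / real n * x) - iexp (t / real n * m)))
            \<le> real n * \<bar>t / real n * x - t / real n * m\<bar>"
          unfolding norm_mult norm_of_nat by (intro mult_left_mono cmod_iexp_diff_le) auto
        also have "\<dots> = real n * \<bar>t / real n * (x - m)\<bar>" by (simp add: right_diff_distrib)
        also have "\<dots> \<le> \<bar>t\<bar> * \<bar>x - m\<bar>" by (cases "n = 0") (auto simp: abs_mult)
        finally show "norm (of_nat n * (iexp (t / real n * x) - iexp (t / real n * m))) \<le> \<bar>t\<bar> * \<bar>x - m\<bar>" .
      qed
    qed auto
    moreover have "(\<integral>x. \<i> * complex_of_real (t * x) - \<i> * complex_of_real (t * m) \<partial>M) = 0"
    proof -
      have "(\<integral>x. \<i> * complex_of_real (t * x) - \<i> * complex_of_real (t * m) \<partial>M)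
          = (\<integral>x. \<i> * complex_of_real (t * (x - m)) \<partial>M)" by (simp add: algebra_simps)
      also have "\<dots> = \<i> * complex_of_real (\<integral>x. t * (x - m) \<partial>M)"
        by (subst integral_mult_right_zero, subst integral_complex_of_real) simp
      also have "(\<integral>x. t * (x - m) \<partial>M) = 0"
        using int prob_space by (simp add: m_def)
      finally show ?thesis by simp
    qed
    moreover have "(\<integral>x. of_nat n * (iexp (t / real n * x) - iexp (t / real n * m)) \<partial>M)
        = of_nat n * (char M (t / real n) - iexp (t / real n * m))" for n
    proof -
      have "(\<integral>x. iexp (t / real n * x) - iexp (t / real n * m) \<partial>M) = char M (t / real n) - iexp (t / real n * m)"
      proof -
        have "complex_integrable M (\<lambda>x. iexp (t / real n * x))" by (rule integrable_iexp) (auto simp del: of_real_mult of_real_divide)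
        then show ?thesis unfolding char_def using prob_space
          by (subst Bochner_Integration.integral_diff) auto
      qed
      then show ?thesis by simp
    qed
    ultimately have lim: "(\<lambda>n. of_nat n * (char M (t / real n) - iexp (t / real n * m))) \<longlonglongrightarrow> 0"
      by (simp only:)
    have "(\<lambda>n. char (N n) t - iexp (t * m)) \<longlonglongrightarrow> 0"
    proof (rule Lim_null_comparison[OF _ tendsto_norm_zero[OF lim]])
      show "\<forall>\<^sub>F n in sequentially. norm (char (N n) t - iexp (t * m))
          \<le> norm (of_nat n * (char M (t / real n) - iexp (t / real n * m)))"
        using eventually_gt_at_top[of 0]
      proof eventually_elim
        case (elim n)
        \<comment> \<open>Both sides are now \<open>n\<close>-th powers of numbers of modulus at
          most 1, whose difference is at most \<open>n\<close> times that of the bases; no complex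
          logarithm is involved.\<close>
        have "iexp (t * m) = iexp (t / real n * m) ^ n"
          using elim by (simp add: exp_of_nat_mult[symmetric])
        then have "norm (char (N n) t - iexp (t * m)) \<le> real n * norm (char M (t / real n) - iexp (t / real n * m))"
          unfolding charN by (simp only:) (rule norm_power_diff, auto intro: cmod_char_le_1)
        then show ?case by (simp add: norm_mult)
      qed
    qed
    moreover have "char (return borel m) t = iexp (t * m)" by (simp add: char_def integral_return)
    ultimately show ?thesis by (simp add: LIM_zero_iff)
  qed
  have wk: "weak_conv_m N (return borel m)" by (rule levy_continuity[OF rN rR conv])
  \<comment> \<open>A continuous cutoff: 1 up to \<open>m / 2\<close>, 0 from \<open>m\<close>
    on.\<close>
  define b where "b s = max 0 (min 1 (2 - 2 * s / m))" for s :: real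
  have bcont: "isCont b s" for s unfolding b_def by (intro continuous_intros) (use m in auto)
  have "(\<lambda>n. \<integral>s. b s \<partial>N n) \<longlonglongrightarrow> (\<integral>s. b s \<partial>return borel m)"
    by (rule weak_conv_imp_integral_bdd_continuous_conv[OF rN rR wk bcont, where B=1])
      (auto simp: b_def)
  moreover have [measurable]: "b \<in> borel_measurable borel" unfolding b_def by measurable
  moreover have "b m = 0" using m by (simp add: b_def)
  ultimately have lim: "(\<lambda>n. \<integral>s. b s \<partial>N n) \<longlonglongrightarrow> 0" by (simp add: integral_return)
  obtain n0 :: nat where n0: "2 * x / m < real n0" using reals_Archimedean2 by blast
  show ?thesis
  proof (rule Lim_null_comparison[OF _ lim])
    show "\<forall>\<^sub>F n in sequentially. norm (measure (conv_power M n) {..x}) \<le> (\<integral>s. b s \<partial>N n)"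
      using eventually_gt_at_top[of n0]
    proof eventually_elim
      case (elim n)
      interpret C: real_distribution "conv_power M n" by (rule real_distribution_conv_power)
      have n: "real n > 0" "x < m / 2 * real n" using n0 elim m
        by (auto simp: field_simps intro: less_trans)
      have "(\<integral>s. indicator {..x} s \<partial>conv_power M n) \<le> (\<integral>s. b (s / real n) \<partial>conv_power M n)"
      proof (rule integral_mono)
        show "integrable (conv_power M n) (indicat_real {..x})"
          by (rule C.integrable_const_bound[where B=1]) auto
        show "integrable (conv_power M n) (\<lambda>s. b (s / real n))"
          by (rule C.integrable_const_bound[where B=1]) (auto simp: b_def)
        fix s
        show "indicator {..x} s \<le> b (s / real n)"
        proof (cases "s \<le> x")
          case True
          then have "s / real n \<le> m / 2" using n by (simp add: field_simps)
          then have "2 * (s / real n) / m \<le> 1" by (simp only: divide_le_eq_1_pos[OF m])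
          then show ?thesis by (simp add: b_def indicator_def)
        qed (simp add: b_def)
      qed
      then show ?case by (simp add: N_def integral_distr)
    qed
  qed
qed

end

section \<open>Exponential kernels\<close>

text \<open>Cutting \<open>[x, x + h]\<close> into \<open>n\<close> equal pieces replaces the factor \<open>exp (c h)\<close> by
  \<open>exp (c h / n)\<close>.\<close>

lemma increments_le:
  fixes J :: "real \<Rightarrow> real"
  assumes J: "\<And>x h. h \<ge> 0 \<Longrightarrow> J (x + h) - J x \<le> h * exp (c * h) * B" and h: "h \<ge> 0"
  shows "J (x + h) - J x \<le> h * B"
proof -
  have le: "J (x + h) - J x \<le> h * exp (c * (h / real (Suc n))) * B" for n
  proof -
    let ?d = "h / real (Suc n)"
    have "J (x + h) - J x = (\<Sum>k<Suc n. J (x + real (Suc k) * ?d) - J (x + real k * ?d))"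
      by (subst sum_lessThan_telescope) simp
    also have "\<dots> \<le> (\<Sum>k<Suc n. ?d * exp (c * ?d) * B)"
    proof (rule sum_mono)
      fix k
      have "x + real (Suc k) * ?d = (x + real k * ?d) + ?d" by (simp only: of_nat_Suc) argo
      then show "J (x + real (Suc k) * ?d) - J (x + real k * ?d) \<le> ?d * exp (c * ?d) * B"
        using J[of ?d "x + real k * ?d"] h by (simp only: divide_nonneg_nonneg of_nat_0_le_iff)
    qed
    also have "\<dots> = h * exp (c * ?d) * B"
      by (simp del: of_nat_Suc)
    finally show ?thesis .
  qed
  have "(\<lambda>n. h / real (Suc n)) \<longlonglongrightarrow> 0"
    using LIMSEQ_Suc[OF lim_const_over_n[of h]] by simp
  then have "(\<lambda>n. h * exp (c * (h / real (Suc n))) * B) \<longlonglongrightarrow> h * exp (c * 0) * B"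
    by (intro tendsto_intros)
  then have "(\<lambda>n. h * exp (c * (h / real (Suc n))) * B) \<longlonglongrightarrow> h * B" by simp
  then show ?thesis by (rule LIMSEQ_le_const) (use le in auto)
qed

section \<open>One-sided and two-sided exponential kernels and their primitives\<close>

definition expo :: "real \<Rightarrow> real \<Rightarrow> real" where
  "expo g x = (if x \<ge> 0 then exp (- g * x) else 0)"

text \<open>The primitive of \<open>expo g\<close> that vanishes on the negative half-line (for
  \<open>g > 0\<close>).\<close>

definition expo_int :: "real \<Rightarrow> real \<Rightarrow> real" where
  "expo_int g x = (if x \<ge> 0 then (1 - exp (- g * x)) / g else 0)"

definition tent :: "real \<Rightarrow> real \<Rightarrow> real \<Rightarrow> real" where
  "tent e g x = (if x \<ge> 0 then exp (- g * x) else exp (e * x))"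

text \<open>The primitive of \<open>tent e g\<close> that vanishes at minus infinity;
  \<open>1 / e\<close> is the integral of the left tail.\<close>

definition tent_int :: "real \<Rightarrow> real \<Rightarrow> real \<Rightarrow> real" where
  "tent_int e g x = (if x \<ge> 0 then 1 / e + (1 - exp (- g * x)) / g else exp (e * x) / e)"

lemma one_minus_exp_div_le:
  fixes g h :: real assumes "g > 0" shows "(1 - exp (- g * h)) / g \<le> h"
  using exp_ge_add_one_self[of "- g * h"] assms by (simp add: field_simps)

lemma one_minus_exp_div_ge:
  fixes g h :: real assumes "g > 0" shows "h * exp (- g * h) \<le> (1 - exp (- g * h)) / g"
proof -
  have "(1 + g * h) * exp (- g * h) \<le> exp (g * h) * exp (- g * h)"
    using exp_ge_add_one_self[of "g * h"] by (intro mult_right_mono) auto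
  also have "\<dots> = 1" by (simp add: exp_add[symmetric])
  finally show ?thesis using assms by (simp add: field_simps)
qed

lemma one_minus_exp_split:
  fixes g x h :: real
  shows "(1 - exp (- g * (x + h))) / g - (1 - exp (- g * x)) / g = exp (- g * x) * ((1 - exp (- g * h)) / g)"
proof -
  have "exp (- g * (x + h)) = exp (- g * x) * exp (- g * h)"
    by (simp add: exp_add[symmetric] algebra_simps)
  then show ?thesis by (simp add: diff_divide_distrib right_diff_distrib)
qed

text \<open>Before its jump at 0 the kernel vanishes, so only the right endpoint can bound the
  integral over the interval; from there back the kernel grows by at most
  \<open>exp (g * h)\<close>.\<close>

lemma expo_int_increment_le:
  assumes g: "g > 0" and h: "h \<ge> 0"
  shows "expo_int g (x + h) - expo_int g x \<le> h * exp (g * h) * expo g (x + h)"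
proof -
  consider "x \<ge> 0" | "x < 0" "x + h \<ge> 0" | "x + h < 0" using h by linarith
  then show ?thesis
  proof cases
    case 1
    have "expo_int g (x + h) - expo_int g x = exp (- g * x) * ((1 - exp (- g * h)) / g)"
      using 1 h one_minus_exp_split[of g x h] by (simp add: expo_int_def)
    also have "\<dots> \<le> exp (- g * x) * h"
      using one_minus_exp_div_le[OF g, of h] by (intro mult_left_mono) auto
    also have "\<dots> = h * exp (g * h) * expo g (x + h)"
      using 1 h by (simp add: expo_def exp_add[symmetric] algebra_simps)
    finally show ?thesis .
  next
    case 2
    have "expo_int g (x + h) - expo_int g x \<le> x + h"
      using 2 one_minus_exp_div_le[OF g, of "x + h"] by (simp add: expo_int_def)
    also have "\<dots> \<le> h * 1" using 2 by simp
    also have "\<dots> \<le> h * exp (- g * x)" using h g 2 by (intro mult_left_mono) (auto simp: mult_nonneg_nonpos)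
    also have "\<dots> = h * exp (g * h) * expo g (x + h)"
      using 2 h by (simp add: expo_def exp_add[symmetric] algebra_simps)
    finally show ?thesis .
  qed (use h in \<open>auto simp: expo_int_def expo_def\<close>)
qed

lemma expo_int_increment_ge:
  assumes g: "g > 0" and h: "h \<ge> 0"
  shows "h * exp (- g * h) * expo g x \<le> expo_int g (x + h) - expo_int g x"
proof (cases "x \<ge> 0")
  case True
  have "h * exp (- g * h) * expo g x \<le> (1 - exp (- g * h)) / g * exp (- g * x)"
    using mult_right_mono[OF one_minus_exp_div_ge[OF g, of h], of "exp (- g * x)"] True
    by (simp add: expo_def)
  also have "\<dots> = expo_int g (x + h) - expo_int g x"
    using True h one_minus_exp_split[of g x h] by (simp add: expo_int_def)
  finally show ?thesis .
next
  case False
  then show ?thesis using g by (auto simp: expo_int_def expo_def)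
qed

text \<open>To the right the kernel grows at most at the rate \<open>e\<close>; since it has no
  jump, the left endpoint suffices here.\<close>

lemma tent_int_increment_le:
  assumes e: "e > 0" and g: "g > 0" and h: "h \<ge> 0"
  shows "tent_int e g (x + h) - tent_int e g x \<le> h * exp (e * h) * tent e g x"
proof -
  have eh: "1 \<le> exp (e * h)" using e h by simp
  consider "x \<ge> 0" | "x < 0" "x + h \<ge> 0" | "x + h < 0" using h by linarith
  then show ?thesis
  proof cases
    case 1
    have "tent_int e g (x + h) - tent_int e g x = exp (- g * x) * ((1 - exp (- g * h)) / g)"
      using 1 h one_minus_exp_split[of g x h] by (simp add: tent_int_def)
    also have "\<dots> \<le> exp (- g * x) * (h * exp (e * h))"
      using one_minus_exp_div_le[OF g, of h] eh h
      by (intro mult_left_mono) (auto intro: order_trans mult_left_mono[of 1 "exp (e * h)" h, simplified])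
    finally show ?thesis using 1 by (simp add: tent_def mult.commute)
  next
    case 2
    have "(1 - exp (e * x)) / e \<le> - x"
      using one_minus_exp_div_le[OF e, of "- x"] by simp
    then have "tent_int e g (x + h) - tent_int e g x \<le> - x + (x + h)"
      using 2 one_minus_exp_div_le[OF g, of "x + h"] by (simp add: tent_int_def diff_divide_distrib)
    also have "\<dots> \<le> h * exp (e * (x + h))"
      using mult_left_mono[of 1 "exp (e * (x + h))" h] 2 h e by simp
    also have "\<dots> = h * exp (e * h) * tent e g x"
      using 2 by (simp add: tent_def exp_add[symmetric] algebra_simps)
    finally show ?thesis .
  next
    case 3
    have "tent_int e g (x + h) - tent_int e g x = exp (e * (x + h)) * ((1 - exp (- e * h)) / e)"
    proof -
      have "exp (e * x) = exp (e * (x + h)) * exp (- e * h)"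
        by (simp add: exp_add[symmetric] algebra_simps)
      then show ?thesis using 3 h
        by (simp add: tent_int_def diff_divide_distrib right_diff_distrib)
    qed
    also have "\<dots> \<le> exp (e * (x + h)) * h"
      using one_minus_exp_div_le[OF e, of h] by (intro mult_left_mono) auto
    also have "\<dots> = h * exp (e * h) * tent e g x"
      using 3 h by (simp add: tent_def exp_add[symmetric] algebra_simps)
    finally show ?thesis .
  qed
qed

text \<open>At distance \<open>u\<close> to the left of \<open>x\<close> the kernel is still at
  least \<open>exp (- e * u)\<close> times its value at \<open>x\<close>; the factor is the integral
  of this over \<open>[0, h]\<close>.\<close>

lemma tent_int_increment_ge:
  assumes e: "e > 0" and g: "g > 0" and h: "h \<ge> 0"
  shows "tent e g x * ((1 - exp (- e * h)) / e) \<le> tent_int e g x - tent_int e g (x - h)"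
proof -
  consider "x < 0" | "x \<ge> 0" "x - h \<ge> 0" | "x \<ge> 0" "x - h < 0" using h by linarith
  then show ?thesis
  proof cases
    case 1
    have "tent_int e g x - tent_int e g (x - h) = tent e g x * ((1 - exp (- e * h)) / e)"
    proof -
      have "exp (e * (x - h)) = exp (e * x) * exp (- e * h)"
        by (simp add: exp_add[symmetric] algebra_simps)
      then show ?thesis using 1 h
        by (simp add: tent_int_def tent_def diff_divide_distrib right_diff_distrib)
    qed
    then show ?thesis by simp
  next
    case 2
    have "tent e g x * ((1 - exp (- e * h)) / e) \<le> exp (- g * x) * h"
      using mult_left_mono[OF one_minus_exp_div_le[OF e, of h], of "exp (- g * x)"] 2
      by (simp add: tent_def)
    also have "\<dots> = exp (- g * (x - h)) * (h * exp (- g * h))"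
      by (simp add: exp_add[symmetric] algebra_simps)
    also have "\<dots> \<le> exp (- g * (x - h)) * ((1 - exp (- g * h)) / g)"
      using one_minus_exp_div_ge[OF g, of h] by (intro mult_left_mono) auto
    also have "\<dots> = tent_int e g x - tent_int e g (x - h)"
      using 2 one_minus_exp_split[of g "x - h" h] by (simp add: tent_int_def)
    finally show ?thesis .
  next
    case 3
    \<comment> \<open>The integral of \<open>exp (- e * u)\<close> over \<open>[0, h]\<close> is
      split at \<open>u = h - x\<close>, with the second part bounded by its length
      \<open>x\<close>; the parts are matched with the mass of the kernel left and right of
      0.\<close>
    have "(1 - exp (- e * h)) / e
        = (1 - exp (e * (x - h))) / e + exp (e * (x - h)) * ((1 - exp (- e * x)) / e)"
    proof -
      have "exp (- e * h) = exp (e * (x - h)) * exp (- e * x)"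
        by (simp add: exp_add[symmetric] algebra_simps)
      then show ?thesis by (simp add: diff_divide_distrib right_diff_distrib)
    qed
    also have "\<dots> \<le> (1 - exp (e * (x - h))) / e + 1 * x"
      using 3 e one_minus_exp_div_le[OF e, of x]
      by (intro add_left_mono mult_mono) (auto simp: mult_nonneg_nonpos)
    finally have "exp (- g * x) * ((1 - exp (- e * h)) / e)
        \<le> exp (- g * x) * ((1 - exp (e * (x - h))) / e + 1 * x)"
      by (intro mult_left_mono) auto
    also have "\<dots> = exp (- g * x) * ((1 - exp (e * (x - h))) / e) + x * exp (- g * x)"
      by (simp add: algebra_simps)
    also have "\<dots> \<le> 1 * ((1 - exp (e * (x - h))) / e) + (1 - exp (- g * x)) / g"
      using 3 e g one_minus_exp_div_ge[OF g, of x]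
      by (intro add_mono mult_right_mono divide_nonneg_pos) (auto simp: mult_nonneg_nonpos)
    also have "\<dots> = tent_int e g x - tent_int e g (x - h)"
      using 3 by (simp add: tent_int_def diff_divide_distrib)
    finally show ?thesis using 3 by (simp add: tent_def)
  qed
qed

lemma expo_bounds: "g > 0 \<Longrightarrow> 0 \<le> expo g x" "g > 0 \<Longrightarrow> expo g x \<le> 1"
  by (auto simp: expo_def)

lemma expo_int_bounds:
  assumes "g > 0"
  shows "0 \<le> expo_int g x" "expo_int g x \<le> 1 / g" "expo_int g x \<le> 1 / g * indicator {0..} x"
  using assms by (auto simp: expo_int_def divide_le_cancel)

lemma tent_bounds:
  assumes "e > 0" "g > 0"
  shows "0 \<le> tent e g x" "tent e g x \<le> 1" "expo g x \<le> tent e g x"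
  using assms by (auto simp: tent_def expo_def mult_nonneg_nonpos)

lemma tent_int_bounds:
  assumes "e > 0" "g > 0"
  shows "0 \<le> tent_int e g x" "tent_int e g x \<le> 1 / e + 1 / g"
proof -
  show "0 \<le> tent_int e g x" using assms by (auto simp: tent_int_def)
  show "tent_int e g x \<le> 1 / e + 1 / g"
  proof (cases "x \<ge> 0")
    case True
    then show ?thesis using assms by (simp add: tent_int_def divide_le_cancel)
  next
    case False
    then have "exp (e * x) / e \<le> 1 / e" using assms by (simp add: divide_le_cancel mult_nonneg_nonpos)
    also have "\<dots> \<le> 1 / e + 1 / g" using assms by simp
    finally show ?thesis using False by (simp add: tent_int_def)
  qed
qed

lemma kernel_measurable [measurable]:
  "expo g \<in> borel_measurable borel" "expo_int g \<in> borel_measurable borel"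
  "tent e g \<in> borel_measurable borel" "tent_int e g \<in> borel_measurable borel"
  unfolding expo_def[abs_def] expo_int_def[abs_def] tent_def[abs_def] tent_int_def[abs_def] by measurable

section \<open>Renewal theorem for walks with positive drift\<close>

locale drift_walk = real_distribution F for F +
  fixes g :: real
  assumes integrable_id: "integrable F (\<lambda>t. t)"
    and mean_pos: "(\<integral>t. t \<partial>F) > 0"
    and g_pos: "g > 0"
begin

section \<open>Means of a kernel along the walk\<close>

definition kernel_mean :: "(real \<Rightarrow> real) \<Rightarrow> nat \<Rightarrow> real \<Rightarrow> real" where
  "kernel_mean k n x = (\<integral>s. k (x - s) \<partial>conv_power F n)"

context
  fixes k :: "real \<Rightarrow> real" and B :: real
  assumes k_measurable [measurable]: "k \<in> borel_measurable borel"
    and k_nonneg: "\<And>x. 0 \<le> k x" and k_le: "\<And>x. k x \<le> B"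
begin

lemma integrable_kernel: "integrable (conv_power F n) (\<lambda>s. k (x - s))"
proof -
  interpret N: real_distribution "conv_power F n" by (rule real_distribution_conv_power)
  show ?thesis by (rule N.integrable_const_bound[where B=B]) (use k_nonneg k_le in auto)
qed

lemma kernel_mean_nonneg: "0 \<le> kernel_mean k n x"
  unfolding kernel_mean_def by (rule Bochner_Integration.integral_nonneg) (use k_nonneg in auto)

lemma kernel_mean_le: "kernel_mean k n x \<le> B"
proof -
  interpret N: real_distribution "conv_power F n" by (rule real_distribution_conv_power)
  have "kernel_mean k n x \<le> (\<integral>s. B \<partial>conv_power F n)"
    unfolding kernel_mean_def by (rule integral_mono) (use integrable_kernel k_le in auto)
  then show ?thesis using N.prob_space by simp
qed

lemma kernel_mean_measurable [measurable]: "kernel_mean k n \<in> borel_measurable borel"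
proof -
  interpret N: real_distribution "conv_power F n" by (rule real_distribution_conv_power)
  show ?thesis unfolding kernel_mean_def[abs_def] by measurable
qed

lemma kernel_mean_0: "kernel_mean k 0 x = k x"
  by (simp add: kernel_mean_def integral_return)

lemma kernel_mean_Suc: "kernel_mean k (Suc n) x = (\<integral>t. kernel_mean k n (x - t) \<partial>F)"
proof -
  have "kernel_mean k (Suc n) x = (\<integral>t. \<integral>s. k (x - (t + s)) \<partial>conv_power F n \<partial>F)"
    unfolding kernel_mean_def by (rule integral_conv_power_Suc[where B=B]) (use k_nonneg k_le in auto)
  then show ?thesis by (simp add: kernel_mean_def algebra_simps)
qed

text \<open>Averaging over one step raises the index by one, so the sum telescopes. It stays
  truncated at \<open>N\<close> because the full sums may diverge.\<close>

lemma kernel_mean_identity: "(\<integral>t. (\<Sum>n<N. kernel_mean k n x - kernel_mean k n (x - t)) \<partial>F) = k x - kernel_mean k N x"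
proof -
  have int: "integrable F (\<lambda>t. kernel_mean k n (x - t))" for n
    by (rule integrable_const_bound[where B=B]) (use kernel_mean_nonneg kernel_mean_le in auto)
  have "(\<integral>t. (\<Sum>n<N. kernel_mean k n x - kernel_mean k n (x - t)) \<partial>F) = (\<Sum>n<N. kernel_mean k n x - kernel_mean k (Suc n) x)"
    using int prob_space by (simp add: kernel_mean_Suc Bochner_Integration.integral_sum)
  also have "\<dots> = k x - kernel_mean k N x"
    by (subst sum_lessThan_telescope') (simp add: kernel_mean_0)
  finally show ?thesis .
qed

end

lemma kernel_mean_mono:
  assumes "\<And>n. integrable (conv_power F n) (\<lambda>s. k (x - s))" "\<And>n. integrable (conv_power F n) (\<lambda>s. k' (y - s))"
    and "\<And>s. k (x - s) \<le> k' (y - s)"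
  shows "kernel_mean k n x \<le> kernel_mean k' n y"
  unfolding kernel_mean_def using assms by (intro integral_mono)

lemmas expo_facts = kernel_measurable(1) expo_bounds[OF g_pos]
lemmas expo_int_facts = kernel_measurable(2) expo_int_bounds(1,2)[OF g_pos]

text \<open>The kernel \<open>tent e g\<close> dominates \<open>expo g\<close> and loses at most a factor \<open>exp (- e t)\<close> when shifted
  left by \<open>t\<close>. Let \<open>\<Phi>\<close> be its partial potential and \<open>J\<close> the primitive of \<open>\<Phi>\<close>. The mean of
  \<open>J x - J (x - t)\<close> under \<open>F\<close> telescopes, hence is at most \<open>K = 1 / e + 1 / g\<close>. At a point where
  \<open>\<Phi>\<close> is nearly its supremum \<open>S\<close>, this mean is also at least \<open>S\<close> times the mean of
  \<open>(1 - exp (- e t\<^sup>+)) / e - t\<^sup>-\<close>, which tends to the mean of \<open>t\<close> as \<open>e\<close> tends to \<open>0\<close>.\<close>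

lemma expo_potential_bounded: obtains B where "\<And>N x. (\<Sum>n<N. kernel_mean (expo g) n x) \<le> B"
proof -
  define pp where "pp t = max t 0" for t :: real
  define nn where "nn t = max (- t) 0" for t :: real
  have pn: "integrable F pp" "integrable F nn"
    unfolding pp_def[abs_def] nn_def[abs_def] using integrable_id by auto
  have "(\<integral>t. t \<partial>F) = (\<integral>t. pp t - nn t \<partial>F)"
    by (intro Bochner_Integration.integral_cong) (auto simp: pp_def nn_def)
  then have mean: "(\<integral>t. t \<partial>F) = (\<integral>t. pp t \<partial>F) - (\<integral>t. nn t \<partial>F)" using pn by simp
  \<comment> \<open>This is the integral of \<open>exp (- e * u)\<close> over
    \<open>[0, pp t]\<close>, the factor from \<open>tent_int_increment_ge\<close> for a step to the
    right.\<close>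
  define w where "w e t = (1 - exp (- e * pp t)) / e" for e t :: real
  have w_le: "w e t \<le> pp t" if "e > 0" for e t
    unfolding w_def by (rule one_minus_exp_div_le[OF that])
  have w_nonneg: "0 \<le> w e t" if "e > 0" for e t
    using that by (auto simp: w_def pp_def)
  have w_meas[measurable]: "w e \<in> borel_measurable borel" for e
    unfolding w_def[abs_def] pp_def[abs_def] by measurable
  have int_w: "integrable F (w e)" if "e > 0" for e
    by (rule Bochner_Integration.integrable_bound[OF pn(1)])
      (use w_le w_nonneg that in \<open>auto simp: pp_def\<close>)
  have "(\<lambda>n. \<integral>t. w (1 / real (Suc n)) t \<partial>F) \<longlonglongrightarrow> (\<integral>t. pp t \<partial>F)"
  proof (rule integral_dominated_convergence[OF _ _ pn(1)])
    show "AE t in F. (\<lambda>n. w (1 / real (Suc n)) t) \<longlonglongrightarrow> pp t"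
    proof (rule AE_I2)
      fix t
      have "(\<lambda>n. 1 / real (Suc n)) \<longlonglongrightarrow> 0"
        using LIMSEQ_Suc[OF lim_const_over_n[of 1]] by simp
      then have lim: "(\<lambda>n. pp t * exp (- (1 / real (Suc n)) * pp t)) \<longlonglongrightarrow> pp t * exp (- 0 * pp t)"
        by (intro tendsto_intros)
      show "(\<lambda>n. w (1 / real (Suc n)) t) \<longlonglongrightarrow> pp t"
      proof (rule tendsto_sandwich[OF _ _ _ tendsto_const])
        show "(\<lambda>n. pp t * exp (- (1 / real (Suc n)) * pp t)) \<longlonglongrightarrow> pp t" using lim by simp
        show "\<forall>\<^sub>F n in sequentially. pp t * exp (- (1 / real (Suc n)) * pp t) \<le> w (1 / real (Suc n)) t"
          unfolding w_def by (intro always_eventually allI one_minus_exp_div_ge) simp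
        show "\<forall>\<^sub>F n in sequentially. w (1 / real (Suc n)) t \<le> pp t"
          by (intro always_eventually allI w_le) simp
      qed
    qed
    show "AE t in F. norm (w (1 / real (Suc n)) t) \<le> pp t" for n
      using w_le[of "1 / real (Suc n)"] w_nonneg[of "1 / real (Suc n)"] by auto
  qed (use pn in auto)
  \<comment> \<open>Positive drift says that the mean of \<open>pp\<close> exceeds that of
    \<open>nn\<close>; a small enough \<open>e\<close> preserves the strict inequality.\<close>
  then have "\<forall>\<^sub>F n in sequentially. (\<integral>t. nn t \<partial>F) < (\<integral>t. w (1 / real (Suc n)) t \<partial>F)"
    by (rule order_tendstoD) (use mean mean_pos in simp)
  then obtain n0 where n0: "(\<integral>t. nn t \<partial>F) < (\<integral>t. w (1 / real (Suc n0)) t \<partial>F)"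
    by (auto simp: eventually_sequentially)
  define e where "e = 1 / real (Suc n0)"
  have e: "e > 0" by (simp add: e_def)
  define W where "W = (\<integral>t. w e t \<partial>F)"
  have W: "(\<integral>t. nn t \<partial>F) < W" using n0 by (simp add: W_def e_def)
  have "0 \<le> (\<integral>t. nn t \<partial>F)" by (rule Bochner_Integration.integral_nonneg) (simp add: nn_def)
  then have W0: "W > 0" using W by linarith
  note tf = kernel_measurable(3)[of e g] tent_bounds(1,2)[OF e g_pos]
  note tif = kernel_measurable(4)[of e g] tent_int_bounds[OF e g_pos]
  define K where "K = 1 / e + 1 / g"
  define \<Phi> where "\<Phi> N x = (\<Sum>n<N. kernel_mean (tent e g) n x)" for N x
  define J where "J N x = (\<Sum>n<N. kernel_mean (tent_int e g) n x)" for N x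
  have key: "\<Phi> N x \<le> K / (W - (\<integral>t. nn t \<partial>F))" for N x
  proof -
    \<comment> \<open>This crude bound only makes the supremum \<open>S\<close> finite, so that it
      may be moved across an inequality below; the final bound is free of \<open>N\<close>.\<close>
    have \<Phi>N: "\<Phi> N x \<le> real N" for x
      unfolding \<Phi>_def using sum_bounded_above[of "{..<N}" "\<lambda>n. kernel_mean (tent e g) n x" 1] kernel_mean_le[OF tf] by simp
    have bdd: "bdd_above (range (\<Phi> N))" by (rule bdd_aboveI[of _ "real N"]) (use \<Phi>N in auto)
    define S where "S = (SUP x. \<Phi> N x)"
    have \<Phi>S: "\<Phi> N x \<le> S" for x unfolding S_def by (rule cSUP_upper[OF _ bdd]) simp
    have S0: "S \<ge> 0"
    proof -
      have "0 \<le> \<Phi> N 0" unfolding \<Phi>_def by (intro sum_nonneg kernel_mean_nonneg[OF tf])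
      with \<Phi>S[of 0] show ?thesis by linarith
    qed
    have up: "J N (x + h) - J N x \<le> h * S" if "h \<ge> 0" for x h
    proof (rule increments_le[where c=e, OF _ that])
      fix x h :: real assume h: "h \<ge> 0"
      have "J N (x + h) - J N x = (\<Sum>n<N. kernel_mean (tent_int e g) n (x + h) - kernel_mean (tent_int e g) n x)"
        by (simp add: J_def sum_subtractf)
      also have "\<dots> \<le> (\<Sum>n<N. h * exp (e * h) * kernel_mean (tent e g) n x)"
      proof (rule sum_mono)
        fix n
        have "kernel_mean (tent_int e g) n (x + h) - kernel_mean (tent_int e g) n x
            = (\<integral>s. tent_int e g ((x + h) - s) - tent_int e g (x - s) \<partial>conv_power F n)"
          unfolding kernel_mean_def by (subst Bochner_Integration.integral_diff) (auto intro: integrable_kernel[OF tif])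
        also have "\<dots> \<le> (\<integral>s. h * exp (e * h) * tent e g (x - s) \<partial>conv_power F n)"
        proof (rule integral_mono)
          show "tent_int e g ((x + h) - s) - tent_int e g (x - s) \<le> h * exp (e * h) * tent e g (x - s)" for s
            using tent_int_increment_le[OF e g_pos h, of "x - s"] by (simp add: algebra_simps)
        qed (auto intro: integrable_kernel[OF tif] integrable_kernel[OF tf])
        finally show "kernel_mean (tent_int e g) n (x + h) - kernel_mean (tent_int e g) n x \<le> h * exp (e * h) * kernel_mean (tent e g) n x"
          by (simp add: kernel_mean_def)
      qed
      also have "\<dots> = h * exp (e * h) * \<Phi> N x" by (simp add: \<Phi>_def sum_distrib_left)
      also have "\<dots> \<le> h * exp (e * h) * S" using \<Phi>S h by (intro mult_left_mono) auto
      finally show "J N (x + h) - J N x \<le> h * exp (e * h) * S" .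
    qed
    \<comment> \<open>Steps to the right gain a multiple of the value at \<open>x\<close> itself;
      steps to the left lose at most \<open>S\<close> per unit length.\<close>
    have low: "\<Phi> N x * w e t - S * nn t \<le> (\<Sum>n<N. kernel_mean (tent_int e g) n x - kernel_mean (tent_int e g) n (x - t))" for x t
    proof (cases "t \<ge> 0")
      case True
      have "\<Phi> N x * w e t = (\<Sum>n<N. kernel_mean (tent e g) n x * ((1 - exp (- e * t)) / e))"
        using True by (simp add: \<Phi>_def w_def pp_def sum_distrib_right sum_divide_distrib)
      also have "\<dots> \<le> (\<Sum>n<N. kernel_mean (tent_int e g) n x - kernel_mean (tent_int e g) n (x - t))"
      proof (rule sum_mono)
        fix n
        have "kernel_mean (tent e g) n x * ((1 - exp (- e * t)) / e)
            = (\<integral>s. tent e g (x - s) * ((1 - exp (- e * t)) / e) \<partial>conv_power F n)"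
          by (simp add: kernel_mean_def)
        also have "\<dots> \<le> (\<integral>s. tent_int e g (x - s) - tent_int e g ((x - t) - s) \<partial>conv_power F n)"
        proof (rule integral_mono)
          show "tent e g (x - s) * ((1 - exp (- e * t)) / e) \<le> tent_int e g (x - s) - tent_int e g ((x - t) - s)" for s
            using tent_int_increment_ge[OF e g_pos True, of "x - s"] by (simp add: algebra_simps)
        qed (intro Bochner_Integration.integrable_diff integrable_mult_left
            integrable_kernel[OF tif] integrable_kernel[OF tf])+
        also have "\<dots> = kernel_mean (tent_int e g) n x - kernel_mean (tent_int e g) n (x - t)"
          unfolding kernel_mean_def by (subst Bochner_Integration.integral_diff) (auto intro: integrable_kernel[OF tif])
        finally show "kernel_mean (tent e g) n x * ((1 - exp (- e * t)) / e) \<le> kernel_mean (tent_int e g) n x - kernel_mean (tent_int e g) n (x - t)" .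
      qed
      finally show ?thesis using True by (simp add: nn_def)
    next
      case False
      then show ?thesis using up[of "- t" x]
        by (simp add: w_def pp_def nn_def J_def sum_subtractf mult.commute)
    qed
    have "\<Phi> N x * W \<le> K + S * (\<integral>t. nn t \<partial>F)" for x
    proof -
      have "\<Phi> N x * W - S * (\<integral>t. nn t \<partial>F) = (\<integral>t. \<Phi> N x * w e t - S * nn t \<partial>F)"
        using int_w[OF e] pn by (simp add: W_def)
      also have "\<dots> \<le> (\<integral>t. (\<Sum>n<N. kernel_mean (tent_int e g) n x - kernel_mean (tent_int e g) n (x - t)) \<partial>F)"
      proof (rule integral_mono[OF _ _ low])
        have [measurable]: "kernel_mean (tent_int e g) n \<in> borel_measurable borel" for n
          by (rule kernel_mean_measurable[OF tif])
        show "integrable F (\<lambda>t. \<Sum>n<N. kernel_mean (tent_int e g) n x - kernel_mean (tent_int e g) n (x - t))"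
          by (intro Bochner_Integration.integrable_sum Bochner_Integration.integrable_diff integrable_const
              integrable_const_bound[where B="1 / e + 1 / g"])
            (use kernel_mean_nonneg[OF tif] kernel_mean_le[OF tif] in auto)
      qed (use int_w[OF e] pn in auto)
      also have "\<dots> = tent_int e g x - kernel_mean (tent_int e g) N x" by (rule kernel_mean_identity[OF tif])
      also have "\<dots> \<le> K" using kernel_mean_nonneg[OF tif, of N x] tif(3)[of x] by (simp add: K_def)
      finally show ?thesis by simp
    qed
    then have "\<Phi> N x \<le> (K + S * (\<integral>t. nn t \<partial>F)) / W" for x
      using W0 by (simp add: pos_le_divide_eq)
    \<comment> \<open>Taking the supremum makes \<open>S\<close> appear on both sides; since
      \<open>W\<close> exceeds the mean of \<open>nn\<close>, the inequality can be solved for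
      \<open>S\<close>.\<close>
    then have "S \<le> (K + S * (\<integral>t. nn t \<partial>F)) / W"
      unfolding S_def by (intro cSUP_least) auto
    then have "S * (W - (\<integral>t. nn t \<partial>F)) \<le> K"
      using W0 by (simp add: pos_le_divide_eq algebra_simps)
    then have "S \<le> K / (W - (\<integral>t. nn t \<partial>F))"
      using W by (simp add: pos_le_divide_eq)
    with \<Phi>S[of x] show ?thesis by linarith
  qed
  show thesis
  proof (rule that)
    fix N x
    have "(\<Sum>n<N. kernel_mean (expo g) n x) \<le> \<Phi> N x"
      unfolding \<Phi>_def using tent_bounds(3)[OF e g_pos]
      by (intro sum_mono kernel_mean_mono integrable_kernel[OF tf] integrable_kernel[OF expo_facts])
    also note key
    finally show "(\<Sum>n<N. kernel_mean (expo g) n x) \<le> K / (W - (\<integral>t. nn t \<partial>F))" .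
  qed
qed

section \<open>The potential, its primitive and the mean identity\<close>

definition Q :: "real \<Rightarrow> real" where "Q x = (\<Sum>n. kernel_mean (expo g) n x)"

text \<open>The terms are centred at \<open>0\<close> because \<open>\<Sum>n. kernel_mean (expo_int g) n x\<close> may diverge: it is
  finite only if the negative part of \<open>F\<close> has a second moment.\<close>

definition J :: "real \<Rightarrow> real" where "J x = (\<Sum>n. kernel_mean (expo_int g) n x - kernel_mean (expo_int g) n 0)"

lemma summable_A_expo: "summable (\<lambda>n. kernel_mean (expo g) n x)"
proof -
  obtain B where "\<And>N x. (\<Sum>n<N. kernel_mean (expo g) n x) \<le> B" by (rule expo_potential_bounded) blast
  then show ?thesis
    by (intro bounded_imp_summable[where B=B] kernel_mean_nonneg[OF expo_facts])
      (metis lessThan_Suc_atMost)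
qed

lemma Q_bounded: obtains B where "B \<ge> 0" "\<And>x. Q x \<le> B" "\<And>x. 0 \<le> Q x"
proof -
  obtain B where B: "\<And>N x. (\<Sum>n<N. kernel_mean (expo g) n x) \<le> B" by (rule expo_potential_bounded) blast
  have "0 \<le> B" using B[of 0 0] by simp
  moreover have "Q x \<le> B" for x
    unfolding Q_def by (rule suminf_le_const[OF summable_A_expo B])
  moreover have "0 \<le> Q x" for x
    unfolding Q_def by (rule suminf_nonneg[OF summable_A_expo kernel_mean_nonneg[OF expo_facts]])
  ultimately show thesis by (rule that)
qed

lemma kernel_mean_increment:
  assumes h: "h \<ge> 0"
  shows "kernel_mean (expo_int g) n (x + h) - kernel_mean (expo_int g) n x \<le> h * exp (g * h) * kernel_mean (expo g) n (x + h)"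
    and "h * exp (- g * h) * kernel_mean (expo g) n x \<le> kernel_mean (expo_int g) n (x + h) - kernel_mean (expo_int g) n x"
proof -
  have eq: "kernel_mean (expo_int g) n (x + h) - kernel_mean (expo_int g) n x
            = (\<integral>s. expo_int g ((x + h) - s) - expo_int g (x - s) \<partial>conv_power F n)"
    unfolding kernel_mean_def by (subst Bochner_Integration.integral_diff) (auto intro: integrable_kernel[OF expo_int_facts])
  note ints = Bochner_Integration.integrable_diff integrable_kernel[OF expo_int_facts]
    integrable_mult_right integrable_kernel[OF expo_facts]
  have "\<dots> \<le> (\<integral>s. h * exp (g * h) * expo g ((x + h) - s) \<partial>conv_power F n)"
  proof (rule integral_mono)
    show "expo_int g ((x + h) - s) - expo_int g (x - s) \<le> h * exp (g * h) * expo g ((x + h) - s)" for s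
      using expo_int_increment_le[OF g_pos h, of "x - s"] by (simp add: algebra_simps)
  qed (intro ints)+
  with eq show "kernel_mean (expo_int g) n (x + h) - kernel_mean (expo_int g) n x \<le> h * exp (g * h) * kernel_mean (expo g) n (x + h)"
    by (simp add: kernel_mean_def)
  have "(\<integral>s. h * exp (- g * h) * expo g (x - s) \<partial>conv_power F n)
      \<le> (\<integral>s. expo_int g ((x + h) - s) - expo_int g (x - s) \<partial>conv_power F n)"
  proof (rule integral_mono)
    show "h * exp (- g * h) * expo g (x - s) \<le> expo_int g ((x + h) - s) - expo_int g (x - s)" for s
      using expo_int_increment_ge[OF g_pos h, of "x - s"] by (simp add: algebra_simps)
  qed (intro ints)+
  with eq show "h * exp (- g * h) * kernel_mean (expo g) n x \<le> kernel_mean (expo_int g) n (x + h) - kernel_mean (expo_int g) n x"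
    by (simp add: kernel_mean_def)
qed

lemma kernel_mean_int_mono: "x \<le> y \<Longrightarrow> kernel_mean (expo_int g) n x \<le> kernel_mean (expo_int g) n y"
  using kernel_mean_increment(2)[of "y - x" n x] kernel_mean_nonneg[OF expo_facts, of n x]
  by (smt (verit) diff_add_cancel exp_ge_zero mult_nonneg_nonneg add.commute)

lemma summable_A_int_diff: "summable (\<lambda>n. kernel_mean (expo_int g) n x - kernel_mean (expo_int g) n y)"
proof -
  have *: "summable (\<lambda>n. kernel_mean (expo_int g) n x - kernel_mean (expo_int g) n y)" if "y \<le> x" for x y
  proof (rule summable_comparison_test'[where N=0])
    show "summable (\<lambda>n. (x - y) * exp (g * (x - y)) * kernel_mean (expo g) n x)"
      by (rule summable_mult[OF summable_A_expo])
    show "norm (kernel_mean (expo_int g) n x - kernel_mean (expo_int g) n y) \<le> (x - y) * exp (g * (x - y)) * kernel_mean (expo g) n x" for n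
      using kernel_mean_increment(1)[of "x - y" n y] kernel_mean_int_mono[OF that, of n] that by simp
  qed
  show ?thesis
  proof (cases "y \<le> x")
    case False
    then show ?thesis using summable_minus[OF *[of x y]] by simp
  qed (rule *)
qed

lemma J_diff: "J x - J y = (\<Sum>n. kernel_mean (expo_int g) n x - kernel_mean (expo_int g) n y)"
  unfolding J_def using summable_A_int_diff by (subst suminf_diff) auto

text \<open>Since \<open>exp (g * x) * Q x\<close> is nondecreasing, \<open>Q\<close> on an interval
  lies between its endpoint values up to factors \<open>exp (g * h)\<close>. Here this is inherited
  termwise from the kernels, and it later recovers \<open>Q\<close> from \<open>J\<close>.\<close>

lemma J_increment:
  assumes h: "h \<ge> 0"
  shows "J (x + h) - J x \<le> h * exp (g * h) * Q (x + h)"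
    and "h * exp (- g * h) * Q x \<le> J (x + h) - J x"
  unfolding J_diff Q_def
  by (auto simp only: suminf_mult[OF summable_A_expo, symmetric]
      intro!: suminf_le kernel_mean_increment[OF h] summable_A_int_diff summable_mult[OF summable_A_expo])

lemma J_lipschitz:
  obtains B where "\<And>x y. \<bar>J x - J y\<bar> \<le> B * \<bar>x - y\<bar>"
proof -
  obtain B where B: "B \<ge> 0" "\<And>x. Q x \<le> B" "\<And>x. 0 \<le> Q x" by (rule Q_bounded) blast
  have up: "J (x + h) - J x \<le> h * B" if "h \<ge> 0" for x h
  proof (rule increments_le[OF _ that])
    fix x h :: real assume h: "h \<ge> 0"
    have "J (x + h) - J x \<le> h * exp (g * h) * Q (x + h)" by (rule J_increment[OF h])
    also have "\<dots> \<le> h * exp (g * h) * B" using B h by (intro mult_left_mono) auto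
    finally show "J (x + h) - J x \<le> h * exp (g * h) * B" .
  qed
  have lo: "0 \<le> J (x + h) - J x" if "h \<ge> 0" for x h
    using J_increment(2)[OF that, of x] B(3)[of x] that
    by (meson exp_ge_zero mult_nonneg_nonneg order_trans)
  have "\<bar>J x - J y\<bar> \<le> B * \<bar>x - y\<bar>" for x y
  proof (cases "y \<le> x")
    case True
    then show ?thesis using up[of "x - y" y] lo[of "x - y" y] by (simp add: mult.commute)
  next
    case False
    then show ?thesis using up[of "y - x" x] lo[of "y - x" x] by (simp add: mult.commute)
  qed
  then show thesis by (rule that)
qed

text \<open>The kernel is at most \<open>1 / g\<close> and vanishes on negative arguments, so only
  positions up to \<open>x\<close> count, and the walk drifts away from them. This removes the
  remainder of the telescoping sum.\<close>

lemma kernel_mean_int_tendsto_0: "(\<lambda>n. kernel_mean (expo_int g) n x) \<longlonglongrightarrow> 0"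
proof (rule Lim_null_comparison)
  show "(\<lambda>n. 1 / g * measure (conv_power F n) {..x}) \<longlonglongrightarrow> 0"
    using tendsto_mult[OF tendsto_const conv_power_tends_to_infinity[OF integrable_id mean_pos], of "1 / g" x] by simp
  show "\<forall>\<^sub>F n in sequentially. norm (kernel_mean (expo_int g) n x) \<le> 1 / g * measure (conv_power F n) {..x}"
  proof (rule always_eventually, rule allI)
    fix n
    interpret N: real_distribution "conv_power F n" by (rule real_distribution_conv_power)
    have "kernel_mean (expo_int g) n x \<le> (\<integral>s. 1 / g * indicator {..x} s \<partial>conv_power F n)"
      unfolding kernel_mean_def
    proof (rule integral_mono[OF integrable_kernel[OF expo_int_facts]])
      show "integrable (conv_power F n) (\<lambda>s. 1 / g * indicator {..x} s)"
        by (rule N.integrable_const_bound[where B="1/g"]) (use g_pos in \<open>auto simp: indicator_def\<close>)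
      show "expo_int g (x - s) \<le> 1 / g * indicator {..x} s" for s
        using expo_int_bounds(3)[OF g_pos, of "x - s"] by (auto simp: indicator_def)
    qed
    then show "norm (kernel_mean (expo_int g) n x) \<le> 1 / g * measure (conv_power F n) {..x}"
      using kernel_mean_nonneg[OF expo_int_facts, of n x] by simp
  qed
qed

lemma J_identity: "(\<integral>t. J x - J (x - t) \<partial>F) = expo_int g x"
proof -
  obtain B where B: "\<And>x y. \<bar>J x - J y\<bar> \<le> B * \<bar>x - y\<bar>" by (rule J_lipschitz) blast
  have B0: "B \<ge> 0" using B[of 0 1] by simp
  have [measurable]: "J \<in> borel_measurable borel"
    by (rule borel_measurable_continuous_onI, rule lipschitz_on_continuous_on[of B], rule lipschitz_onI)
      (use B B0 in \<open>auto simp: dist_real_def\<close>)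
  have [measurable]: "kernel_mean (expo_int g) n \<in> borel_measurable borel" for n
    by (rule kernel_mean_measurable[OF expo_int_facts])
  have "(\<lambda>N. \<integral>t. (\<Sum>n<N. kernel_mean (expo_int g) n x - kernel_mean (expo_int g) n (x - t)) \<partial>F)
      \<longlonglongrightarrow> (\<integral>t. J x - J (x - t) \<partial>F)"
  proof (rule integral_dominated_convergence[where w="\<lambda>t. B * \<bar>t\<bar>"])
    show "integrable F (\<lambda>t. B * \<bar>t\<bar>)" using integrable_id by simp
    show "AE t in F. (\<lambda>N. \<Sum>n<N. kernel_mean (expo_int g) n x - kernel_mean (expo_int g) n (x - t)) \<longlonglongrightarrow> J x - J (x - t)"
      unfolding J_diff by (intro AE_I2 summable_LIMSEQ summable_A_int_diff)
    show "AE t in F. norm (\<Sum>n<N. kernel_mean (expo_int g) n x - kernel_mean (expo_int g) n (x - t)) \<le> B * \<bar>t\<bar>" for N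
    proof (rule AE_I2)
      fix t
      \<comment> \<open>By monotonicity all terms have the same sign, so partial sums inherit the
        Lipschitz bound of the full sum.\<close>
      have part: "\<bar>\<Sum>n<N. kernel_mean (expo_int g) n u - kernel_mean (expo_int g) n v\<bar> \<le> B * \<bar>u - v\<bar>" if "v \<le> u" for u v
      proof -
        have "(\<Sum>n<N. kernel_mean (expo_int g) n u - kernel_mean (expo_int g) n v) \<le> J u - J v"
          unfolding J_diff using kernel_mean_int_mono[OF that]
          by (intro sum_le_suminf summable_A_int_diff) auto
        moreover have "0 \<le> (\<Sum>n<N. kernel_mean (expo_int g) n u - kernel_mean (expo_int g) n v)"
          using kernel_mean_int_mono[OF that] by (intro sum_nonneg) auto
        ultimately show ?thesis using B[of u v] by linarith
      qed
      show "norm (\<Sum>n<N. kernel_mean (expo_int g) n x - kernel_mean (expo_int g) n (x - t)) \<le> B * \<bar>t\<bar>"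
        using part[of "x - t" x] part[of x "x - t"]
        by (cases "t \<ge> 0") (auto simp: sum_subtractf abs_minus_commute)
    qed
  qed auto
  moreover have "(\<lambda>N. \<integral>t. (\<Sum>n<N. kernel_mean (expo_int g) n x - kernel_mean (expo_int g) n (x - t)) \<partial>F) \<longlonglongrightarrow> expo_int g x - 0"
    unfolding kernel_mean_identity[OF expo_int_facts] by (intro tendsto_intros kernel_mean_int_tendsto_0)
  ultimately show ?thesis using LIMSEQ_unique by fastforce
qed

section \<open>Limits of the potential\<close>

lemma expo_int_lim: "(expo_int g \<longlongrightarrow> 1 / g) at_top"
proof -
  have "filterlim (\<lambda>x. - g * x) at_bot at_top"
    by (rule filterlim_tendsto_neg_mult_at_bot[OF tendsto_const _ filterlim_ident]) (use g_pos in simp)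
  from filterlim_compose[OF exp_at_bot this] have "((\<lambda>x. exp (- g * x)) \<longlongrightarrow> 0) at_top" .
  then have "((\<lambda>x. (1 - exp (- g * x)) / g) \<longlongrightarrow> (1 - 0) / g) at_top"
    by (intro tendsto_intros) (use g_pos in auto)
  moreover have "\<forall>\<^sub>F x in at_top. expo_int g x = (1 - exp (- g * x)) / g"
    using eventually_ge_at_top[of 0] by eventually_elim (simp add: expo_int_def)
  ultimately show ?thesis by (simp add: tendsto_cong)
qed

lemma renewal_identity_J: obtains B where "renewal_identity F J (expo_int g) B (1 / g)"
proof -
  obtain B where B: "\<And>x y. \<bar>J x - J y\<bar> \<le> B * \<bar>x - y\<bar>" by (rule J_lipschitz) blast
  have "renewal_identity F J (expo_int g) B (1 / g)"
    by unfold_locales (use B integrable_id mean_pos J_identity expo_int_lim in auto)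
  then show thesis by (rule that)
qed

text \<open>For each fixed \<open>h\<close>, the limit of the increments of \<open>J\<close>
  confines \<open>Q\<close> asymptotically between \<open>exp (- g * h) * c\<close> and
  \<open>exp (g * h) * c\<close>; then \<open>h\<close> is taken small.\<close>

theorem Q_limit_non_arithmetic:
  assumes na: "\<And>d. d > 0 \<Longrightarrow> measure F (lattice d) < 1"
  shows "(Q \<longlongrightarrow> 1 / (g * (\<integral>t. t \<partial>F))) at_top"
proof -
  define c where "c = 1 / (g * (\<integral>t. t \<partial>F))"
  have c: "c > 0" using g_pos mean_pos by (simp add: c_def)
  obtain B where "renewal_identity F J (expo_int g) B (1 / g)" by (rule renewal_identity_J)
  then interpret R: renewal_identity F J "expo_int g" B "1 / g" .
  have lim: "((\<lambda>x. J x - J (x - h)) \<longlongrightarrow> h * c) at_top" if "h > 0" for h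
    using R.incr_limit_non_arithmetic[OF na that] by (simp add: c_def)
  have "(Q \<longlongrightarrow> c) at_top"
  proof (rule order_tendstoI)
    fix b assume b: "b < c"
    have "((\<lambda>h. exp (- g * h) * c) \<longlongrightarrow> exp (- g * 0) * c) (at_right 0)"
      by (intro tendsto_intros)
    then have "\<forall>\<^sub>F h in at_right 0. b < exp (- g * h) * c"
      using b by (intro order_tendstoD(1)[where y=c]) auto
    from eventually_happens[OF eventually_conj[OF this eventually_at_right_less]]
    obtain h where h: "b < exp (- g * h) * c" "h > 0" by auto
    have "h * b * exp (g * h) < h * c"
    proof -
      have "b * exp (g * h) < exp (- g * h) * c * exp (g * h)" using h by simp
      also have "\<dots> = c" by (simp add: exp_minus)
      finally show ?thesis using h by simp
    qed
    from order_tendstoD(1)[OF lim[OF h(2)] this]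
    show "\<forall>\<^sub>F x in at_top. b < Q x"
    proof eventually_elim
      case (elim x)
      have "h * b * exp (g * h) < h * exp (g * h) * Q x"
        using less_le_trans[OF elim] J_increment(1)[of h "x - h"] h(2) by (simp only: diff_add_cancel less_imp_le)
      then have "(h * exp (g * h)) * b < (h * exp (g * h)) * Q x" by (simp only: ac_simps)
      then show ?case using h(2) by (simp add: mult_less_cancel_left_pos)
    qed
  next
    fix b assume b: "c < b"
    have "((\<lambda>h. exp (- g * h) * b) \<longlongrightarrow> exp (- g * 0) * b) (at_right 0)"
      by (intro tendsto_intros)
    then have "\<forall>\<^sub>F h in at_right 0. c < exp (- g * h) * b"
      using b by (intro order_tendstoD(1)[where y=b]) auto
    from eventually_happens[OF eventually_conj[OF this eventually_at_right_less]]
    obtain h where h: "c < exp (- g * h) * b" "h > 0" by auto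
    have "((\<lambda>x. J (x + h) - J x) \<longlongrightarrow> h * c) at_top"
    proof -
      have "filterlim (\<lambda>x. x - (- h)) at_top (at_top :: real filter)" by (rule filterlim_minus_const_at_top)
      from filterlim_compose[OF lim[OF h(2)] this] show ?thesis by simp
    qed
    moreover have "h * c < h * (exp (- g * h) * b)" using h by simp
    ultimately have "\<forall>\<^sub>F x in at_top. J (x + h) - J x < h * (exp (- g * h) * b)"
      by (rule order_tendstoD(2))
    then show "\<forall>\<^sub>F x in at_top. Q x < b"
    proof eventually_elim
      case (elim x)
      have "h * exp (- g * h) * Q x < h * exp (- g * h) * b"
        unfolding mult.assoc using elim J_increment(2)[of h x] h(2)
        by (metis le_less_trans less_imp_le mult.assoc)
      then show ?case using h(2) by (simp add: mult_less_cancel_left_pos)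
    qed
  qed
  then show ?thesis by (simp add: c_def)
qed

lemma AE_conv_power_lattice:
  assumes "measure F (lattice d) = 1"
  shows "AE s in conv_power F n. s \<in> lattice d"
proof -
  have [measurable]: "lattice d \<in> sets borel" using closed_lattice by auto
  have aF: "AE t in F. t \<in> lattice d" using prob_eq_1[of "lattice d"] assms by simp
  show ?thesis
  proof (induction n)
    case 0
    have "0 \<in> lattice d" unfolding lattice_def by (rule range_eqI[of _ _ 0]) simp
    then show ?case unfolding conv_power.simps by (subst AE_return) auto
  next
    case (Suc n)
    interpret N: real_distribution "conv_power F n" by (rule real_distribution_conv_power)
    interpret P: pair_sigma_finite F "conv_power F n" ..
    have "AE t in F. AE s in conv_power F n. t + s \<in> lattice d"
      using aF
    proof eventually_elim
      case (elim t)
      show ?case using Suc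
      proof eventually_elim
        case (elim s)
        from elim \<open>t \<in> lattice d\<close> obtain i j :: int where "t = d * of_int i" "s = d * of_int j"
          by (auto simp: lattice_def)
        then have "t + s = d * of_int (i + j)" by (simp add: algebra_simps)
        then show ?case unfolding lattice_def by blast
      qed
    qed
    moreover have "(\<lambda>(t, s). t + s) -` lattice d \<inter> space (F \<Otimes>\<^sub>M conv_power F n) \<in> sets (F \<Otimes>\<^sub>M conv_power F n)"
      by (rule measurable_sets[where A=borel]) simp_all
    ultimately have "AE p in F \<Otimes>\<^sub>M conv_power F n. (case p of (t, s) \<Rightarrow> t + s) \<in> lattice d"
      by (intro P.AE_pair_measure) (simp_all add: vimage_def Int_def conj_commute del: space_pair_measure)
    then show ?case unfolding conv_power.simps convolution_def by (subst AE_distr_iff) auto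
  qed
qed

text \<open>No small \<open>h\<close> is available on a lattice, but none is needed: between
  neighbouring lattice points the increment of \<open>expo_int g\<close> is an exact multiple of
  \<open>expo g\<close>, so \<open>Q\<close> is read off from one increment of
  \<open>J\<close>.\<close>

theorem Q_limit_arithmetic:
  assumes d: "d > 0" and md: "measure F (lattice d) = 1"
    and mx: "\<And>d'. measure F (lattice d') = 1 \<Longrightarrow> d' \<le> d"
  shows "(\<lambda>n. Q (d * real n)) \<longlonglongrightarrow> d / ((1 - exp (- d * g)) * (\<integral>t. t \<partial>F))"
proof -
  obtain B where "renewal_identity F J (expo_int g) B (1 / g)" by (rule renewal_identity_J)
  then interpret R: renewal_identity F J "expo_int g" B "1 / g" .
  \<comment> \<open>The integral of \<open>expo g\<close> over one span
    \<open>[0, d]\<close>.\<close>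
  define q where "q = (1 - exp (- g * d)) / g"
  have q: "q > 0" using d g_pos by (simp add: q_def)
  have step: "J (d * real n + d) - J (d * real n) = q * Q (d * real n)" for n
  proof -
    have "kernel_mean (expo_int g) k (d * real n + d) - kernel_mean (expo_int g) k (d * real n) = q * kernel_mean (expo g) k (d * real n)" for k
    proof -
      have "kernel_mean (expo_int g) k (d * real n + d) - kernel_mean (expo_int g) k (d * real n)
          = (\<integral>s. expo_int g (d * real n + d - s) - expo_int g (d * real n - s) \<partial>conv_power F k)"
        unfolding kernel_mean_def by (subst Bochner_Integration.integral_diff) (auto intro: integrable_kernel[OF expo_int_facts])
      also have "\<dots> = (\<integral>s. q * expo g (d * real n - s) \<partial>conv_power F k)"
      proof (rule integral_cong_AE)
        show "AE s in conv_power F k. expo_int g (d * real n + d - s) - expo_int g (d * real n - s) = q * expo g (d * real n - s)"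
          using AE_conv_power_lattice[OF md]
        proof eventually_elim
          case (elim s)
          then obtain i :: int where s: "s = d * of_int i" by (auto simp: lattice_def)
          let ?z = "d * real n - s"
          have z: "?z = d * of_int (int n - i)" by (simp add: s algebra_simps)
          show ?case
          proof (cases "?z \<ge> 0")
            case True
            have "d * real n + d - s = ?z + d" by simp
            then show ?thesis using True d one_minus_exp_split[of g ?z d]
              by (simp only: expo_int_def expo_def q_def if_True add_nonneg_nonneg less_imp_le mult.commute)
          next
            case False
            \<comment> \<open>A negative lattice point is at most \<open>- d\<close>, so one span
              further at most 0 is reached, where \<open>expo_int g\<close> still vanishes.\<close>
            then have "int n - i < 0" using z d by (simp add: zero_le_mult_iff not_le)
            then have "of_int (int n - i) \<le> (-1 :: real)" by linarith
            then have "?z \<le> d * (-1)" unfolding z using d by (intro mult_left_mono) auto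
            then have le: "?z + d \<le> 0" by simp
            then have "expo_int g (?z + d) = 0" by (cases "?z + d = 0") (auto simp: expo_int_def)
            moreover have "d * real n + d - s = ?z + d" by simp
            ultimately show ?thesis using False by (simp only: expo_int_def expo_def if_False)
          qed
        qed
      qed auto
      finally show ?thesis by (simp add: kernel_mean_def)
    qed
    then show ?thesis unfolding J_diff Q_def using suminf_mult[OF summable_A_expo] by simp
  qed
  have "filterlim (\<lambda>n. d * real n) at_top sequentially"
    by (rule filterlim_tendsto_pos_mult_at_top[OF tendsto_const d filterlim_real_sequentially])
  then have "filterlim (\<lambda>n. d + d * real n) at_top sequentially"
    by (rule filterlim_tendsto_add_at_top[OF tendsto_const])
  then have "filterlim (\<lambda>n. d * real n + d) at_top sequentially" by (simp only: add.commute)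
  from filterlim_compose[OF R.incr_limit_arithmetic[OF assms] this]
  have "(\<lambda>n. q * Q (d * real n)) \<longlonglongrightarrow> d * (1 / g) / (\<integral>t. t \<partial>F)" by (simp add: step)
  from tendsto_mult[OF tendsto_const[of "1 / q"] this]
  have "(\<lambda>n. Q (d * real n)) \<longlonglongrightarrow> 1 / q * (d * (1 / g) / (\<integral>t. t \<partial>F))" using q by simp
  then show ?thesis using g_pos by (simp add: q_def mult.commute)
qed

end

section \<open>The Laplace transform\<close>

lemma mult_exp_neg_le:
  fixes c x :: real assumes "c > 0" shows "x * exp (- c * x) \<le> 1 / c"
proof -
  have "c * x * exp (- c * x) \<le> exp (c * x) * exp (- c * x)"
    using exp_ge_add_one_self[of "c * x"] by (intro mult_right_mono) (linarith, simp)
  also have "\<dots> = 1" by (simp add: exp_add[symmetric])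
  finally show ?thesis using assms by (simp add: field_simps)
qed

text \<open>Convexity in the exponent: the left side is the tangent at \<open>s\<close>, evaluated
  at \<open>t\<close>.\<close>

lemma exp_neg_tangent:
  fixes s t x :: real shows "exp (- s * x) - (t - s) * (exp (- s * x) * x) \<le> exp (- t * x)"
proof -
  have "exp (- s * x) * (1 + (- (t - s) * x)) \<le> exp (- s * x) * exp (- (t - s) * x)"
    using exp_ge_add_one_self[of "- (t - s) * x"] by (intro mult_left_mono) auto
  also have "\<dots> = exp (- t * x)" by (simp add: exp_add[symmetric] algebra_simps)
  finally show ?thesis by (simp add: algebra_simps)
qed

text \<open>A majorant for left difference quotients that uses no exponential moment beyond
  \<open>g\<close>: for \<open>x \<ge> 0\<close> the restriction to \<open>s > g / 2\<close> gives a
  constant, for \<open>x < 0\<close> the tangent at \<open>g\<close> suffices.\<close>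

lemma exp_neg_quotient_bound:
  fixes s g x :: real
  assumes s: "g / 2 < s" "s < g" and g: "g > 0"
  shows "\<bar>(exp (- s * x) - exp (- g * x)) / (s - g)\<bar> \<le> 2 / g + \<bar>exp (- g * x) * x\<bar>"
proof (cases "x \<ge> 0")
  case True
  have "exp (- s * x) - exp (- g * x) \<le> (g - s) * (exp (- s * x) * x)"
    using exp_neg_tangent[of s x g] by simp
  moreover have "exp (- g * x) \<le> exp (- s * x)" using s True by (simp add: mult_right_mono)
  moreover have "exp (- s * x) * x \<le> 2 / g"
  proof -
    have "exp (- s * x) * x \<le> exp (- (g / 2) * x) * x"
      using mult_right_mono[of "g / 2" s x] s True by (intro mult_right_mono) auto
    also have "\<dots> \<le> 2 / g" using mult_exp_neg_le[of "g / 2" x] g by (simp add: mult.commute)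
    finally show ?thesis .
  qed
  ultimately have "\<bar>exp (- s * x) - exp (- g * x)\<bar> \<le> (g - s) * (2 / g)"
    using s by (smt (verit) mult_left_mono)
  then have "\<bar>(exp (- s * x) - exp (- g * x)) / (s - g)\<bar> \<le> 2 / g"
    using s by (simp add: abs_divide pos_divide_le_eq mult.commute)
  then show ?thesis by (rule order_trans) simp
next
  case False
  have "exp (- g * x) - exp (- s * x) \<le> (g - s) * \<bar>exp (- g * x) * x\<bar>"
    using exp_neg_tangent[of g x s] False by (simp add: abs_mult algebra_simps)
  moreover have "exp (- s * x) \<le> exp (- g * x)" using s False by (simp add: mult_right_mono_neg)
  ultimately have "\<bar>exp (- s * x) - exp (- g * x)\<bar> \<le> (g - s) * \<bar>exp (- g * x) * x\<bar>" by linarith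
  then have "\<bar>(exp (- s * x) - exp (- g * x)) / (s - g)\<bar> \<le> \<bar>exp (- g * x) * x\<bar>"
    using s by (simp add: abs_divide pos_divide_le_eq mult.commute)
  then show ?thesis using g by (smt (verit) divide_nonneg_pos)
qed

context prob_space
begin

context
  fixes T :: "'a \<Rightarrow> real"
  assumes T_measurable [measurable]: "T \<in> borel_measurable M"
begin

text \<open>This covers an infinite transform too: both sides are then 0 by convention.\<close>

lemma enn2real_laplace: "enn2real (laplace M T s) = (\<integral>\<omega>. exp (- s * T \<omega>) \<partial>M)"
  unfolding laplace_def by (subst integral_eq_nn_integral) auto

lemma laplace_0: "laplace M T 0 = 1"
  by (simp add: laplace_def emeasure_space_1)

lemma laplace_integrable: "laplace M T s < \<infinity> \<Longrightarrow> integrable M (\<lambda>\<omega>. exp (- s * T \<omega>))"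
  by (rule integrableI_bounded) (auto simp: laplace_def)

lemma laplace_eq: "integrable M (\<lambda>\<omega>. exp (- s * T \<omega>)) \<Longrightarrow> laplace M T s = ennreal (\<integral>\<omega>. exp (- s * T \<omega>) \<partial>M)"
  unfolding laplace_def by (rule nn_integral_eq_integral) auto

lemma laplace_eqD:
  assumes "laplace M T s = ennreal c" "c \<ge> 0"
  shows "integrable M (\<lambda>\<omega>. exp (- s * T \<omega>))" "(\<integral>\<omega>. exp (- s * T \<omega>) \<partial>M) = c"
  using assms laplace_integrable[of s] enn2real_laplace[of s] by auto

text \<open>Differentiation under the integral from the left only, since the transform may be
  infinite to the right of \<open>g\<close>.\<close>

lemma laplace_left_deriv_eq:
  assumes g: "g > 0" and int: "integrable M (\<lambda>\<omega>. exp (- g * T \<omega>))"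
    and intT: "integrable M (\<lambda>\<omega>. exp (- g * T \<omega>) * T \<omega>)"
  shows "laplace_left_deriv M T g = - (\<integral>\<omega>. exp (- g * T \<omega>) * T \<omega> \<partial>M)"
proof -
  let ?p = "\<lambda>s. \<integral>\<omega>. exp (- s * T \<omega>) \<partial>M"
  let ?q = "\<lambda>s \<omega>. (exp (- s * T \<omega>) - exp (- g * T \<omega>)) / (s - g)"
  have qint: "integrable M (?q s)" if "g / 2 < s" "s < g" for s
    by (rule Bochner_Integration.integrable_bound[where f="\<lambda>\<omega>. 2 / g + \<bar>exp (- g * T \<omega>) * T \<omega>\<bar>"])
      (use intT exp_neg_quotient_bound[OF that g] in \<open>auto intro: order_trans[OF _ abs_ge_self]\<close>)
  have sint: "integrable M (\<lambda>\<omega>. exp (- s * T \<omega>))" if s: "g / 2 < s" "s < g" for s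
  proof -
    have "integrable M (\<lambda>\<omega>. ?q s \<omega> * (s - g) + exp (- g * T \<omega>))"
      using qint[OF s] int by (intro Bochner_Integration.integrable_add integrable_mult_left) auto
    then show ?thesis using s by simp
  qed
  have "((\<lambda>s. (?p s - ?p g) / (s - g)) \<longlongrightarrow> - (\<integral>\<omega>. exp (- g * T \<omega>) * T \<omega> \<partial>M)) (at_left g)"
  proof (rule tendsto_at_left_sequentially[of "g / 2"])
    show "g / 2 < g" using g by simp
    fix S :: "nat \<Rightarrow> real" assume S: "\<And>n. S n < g" "\<And>n. g / 2 < S n" "S \<longlonglongrightarrow> g"
    have "(\<lambda>n. \<integral>\<omega>. ?q (S n) \<omega> \<partial>M) \<longlonglongrightarrow> (\<integral>\<omega>. - (exp (- g * T \<omega>) * T \<omega>) \<partial>M)"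
    proof (rule integral_dominated_convergence[where w="\<lambda>\<omega>. 2 / g + \<bar>exp (- g * T \<omega>) * T \<omega>\<bar>"])
      show "AE \<omega> in M. (\<lambda>n. ?q (S n) \<omega>) \<longlonglongrightarrow> - (exp (- g * T \<omega>) * T \<omega>)"
      proof (rule AE_I2)
        fix \<omega>
        have "((\<lambda>s. exp (- s * T \<omega>)) has_field_derivative - (exp (- g * T \<omega>) * T \<omega>)) (at g)"
          by (auto intro!: derivative_eq_intros)
        then have "((\<lambda>s. ?q s \<omega>) \<longlongrightarrow> - (exp (- g * T \<omega>) * T \<omega>)) (at g)"
          by (simp add: has_field_derivative_iff)
        moreover have "filterlim S (at g) sequentially"
          using S by (intro filterlim_atI always_eventually) (auto simp: less_imp_neq)
        ultimately show "(\<lambda>n. ?q (S n) \<omega>) \<longlonglongrightarrow> - (exp (- g * T \<omega>) * T \<omega>)"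
          by (rule filterlim_compose)
      qed
      show "AE \<omega> in M. norm (?q (S n) \<omega>) \<le> 2 / g + \<bar>exp (- g * T \<omega>) * T \<omega>\<bar>" for n
        using exp_neg_quotient_bound[OF S(2) S(1) g] by auto
      show "integrable M (\<lambda>\<omega>. 2 / g + \<bar>exp (- g * T \<omega>) * T \<omega>\<bar>)" using intT by auto
    qed auto
    moreover have "(\<integral>\<omega>. ?q (S n) \<omega> \<partial>M) = (?p (S n) - ?p g) / (S n - g)" for n
      using sint[OF S(2) S(1)] int by simp
    ultimately show "(\<lambda>n. (?p (S n) - ?p g) / (S n - g)) \<longlonglongrightarrow> - (\<integral>\<omega>. exp (- g * T \<omega>) * T \<omega> \<partial>M)"
      by (simp only: integral_minus)
  qed
  then have "(?p has_field_derivative - (\<integral>\<omega>. exp (- g * T \<omega>) * T \<omega> \<partial>M)) (at_left g)"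
    by (simp add: has_field_derivative_iff)
  then have "(?p has_vector_derivative - (\<integral>\<omega>. exp (- g * T \<omega>) * T \<omega> \<partial>M)) (at_left g)"
    by (simp add: has_real_derivative_iff_has_vector_derivative)
  then show ?thesis unfolding laplace_left_deriv_def enn2real_laplace
    by (intro vector_derivative_within) (simp_all add: trivial_limit_at_left_real)
qed

text \<open>The transform falls from 1 at 0 to below \<open>exp (- a)\<close> at \<open>t\<close>,
  so a root exists by continuity. The least root \<open>g\<close> lies strictly inside
  \<open>(0, t)\<close>: this gives the moment, and convexity gives its sign.\<close>

lemma exponent_exists_interior:
  assumes a: "a > 0" and t: "t \<ge> 0" "laplace M T t < ennreal (exp (- a))"
  shows "\<exists>\<gamma>>0. laplace M T \<gamma> = ennreal (exp (- a)) \<and>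
           (\<forall>t>0. laplace M T t = ennreal (exp (- a)) \<longrightarrow> \<gamma> \<le> t) \<and>
           integrable M (\<lambda>\<omega>. exp (- \<gamma> * T \<omega>) * T \<omega>) \<and> (\<integral>\<omega>. exp (- \<gamma> * T \<omega>) * T \<omega> \<partial>M) > 0"
proof -
  let ?p = "\<lambda>s. \<integral>\<omega>. exp (- s * T \<omega>) \<partial>M"
  have intt: "integrable M (\<lambda>\<omega>. exp (- t * T \<omega>))"
    using t(2) by (intro laplace_integrable) (auto intro: less_trans)
  have dom: "exp (- s * x) \<le> 1 + exp (- t * x)" if "s \<in> {0..t}" for s x
  proof (cases "x \<ge> 0")
    case True
    then have "exp (- s * x) \<le> 1" using that by simp
    then show ?thesis by (smt (verit) exp_gt_zero)
  next
    case False
    then have "exp (- s * x) \<le> exp (- t * x)" using that by (simp add: mult_right_mono_neg)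
    then show ?thesis by linarith
  qed
  have ints: "integrable M (\<lambda>\<omega>. exp (- s * T \<omega>))" if "s \<in> {0..t}" for s
    by (rule Bochner_Integration.integrable_bound[where f="\<lambda>\<omega>. 1 + exp (- t * T \<omega>)"])
      (use intt dom[OF that] in auto)
  have cont: "continuous_on {0..t} ?p"
    unfolding continuous_on_sequentially comp_def
  proof (intro allI ballI impI, elim conjE)
    fix S :: "nat \<Rightarrow> real" and s assume s: "s \<in> {0..t}" "\<forall>n. S n \<in> {0..t}" "S \<longlonglongrightarrow> s"
    show "(\<lambda>n. ?p (S n)) \<longlonglongrightarrow> ?p s"
    proof (rule integral_dominated_convergence[where w="\<lambda>\<omega>. 1 + exp (- t * T \<omega>)"])
      show "AE \<omega> in M. (\<lambda>n. exp (- S n * T \<omega>)) \<longlonglongrightarrow> exp (- s * T \<omega>)"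
        by (intro AE_I2 tendsto_intros s)
      show "AE \<omega> in M. norm (exp (- S n * T \<omega>)) \<le> 1 + exp (- t * T \<omega>)" for n
        using dom s by auto
    qed (use intt in auto)
  qed
  have pt: "?p t < exp (- a)"
    using t(2) laplace_eq[OF intt] by (simp add: ennreal_less_iff integral_nonneg)
  have p0: "?p 0 = 1" using prob_space by simp
  have a1: "exp (- a) < 1" using a by simp
  define Z where "Z = {s \<in> {0..t}. ?p s = exp (- a)}"
  have cl: "closed Z" unfolding Z_def
    by (rule continuous_closed_preimage_constant[OF cont]) auto
  have ne: "Z \<noteq> {}"
    using IVT2'[of ?p t "exp (- a)" 0] cont pt p0 a1 t(1) by (auto simp: Z_def)
  have bd: "bdd_below Z" by (rule bdd_belowI[of _ 0]) (auto simp: Z_def)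
  define g where "g = Inf Z"
  have gZ: "g \<in> Z" unfolding g_def by (rule closed_contains_Inf[OF ne bd cl])
  then have g: "g \<in> {0..t}" "?p g = exp (- a)" by (auto simp: Z_def)
  then have g0: "g > 0" and gt: "g < t" using p0 a1 pt by (auto simp: less_le)
  have L: "laplace M T g = ennreal (exp (- a))" using laplace_eq[OF ints[OF g(1)]] g(2) by simp
  have least: "g \<le> t'" if "t' > 0" "laplace M T t' = ennreal (exp (- a))" for t'
  proof (cases "t' \<le> t")
    case True
    then have "t' \<in> Z" using laplace_eqD(2)[OF that(2)] that(1) by (simp add: Z_def)
    then show ?thesis unfolding g_def by (rule cInf_lower[OF _ bd])
  next
    case False
    then show ?thesis using gt by linarith
  qed
  \<comment> \<open>The linear factor is absorbed by \<open>g > 0\<close> on the right half-line and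
    by the gap \<open>t - g\<close> on the left one.\<close>
  have bound: "\<bar>exp (- g * x) * x\<bar> \<le> 1 / g + exp (- t * x) * (1 / (t - g))" for x
  proof (cases "x \<ge> 0")
    case True
    then have "\<bar>exp (- g * x) * x\<bar> \<le> 1 / g" using mult_exp_neg_le[OF g0, of x] by (simp add: mult.commute)
    then show ?thesis using gt by (smt (verit) exp_ge_zero mult_nonneg_nonneg divide_nonneg_pos)
  next
    case False
    have "\<bar>exp (- g * x) * x\<bar> = exp (- t * x) * (- x * exp (- (t - g) * - x))"
      using False by (simp add: abs_mult exp_add[symmetric] algebra_simps)
    also have "\<dots> \<le> exp (- t * x) * (1 / (t - g))"
      using mult_exp_neg_le[of "t - g" "- x"] gt by (intro mult_left_mono) auto
    finally show ?thesis using g0 by (smt (verit) divide_nonneg_pos)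
  qed
  have intT: "integrable M (\<lambda>\<omega>. exp (- g * T \<omega>) * T \<omega>)"
    by (rule Bochner_Integration.integrable_bound[where f="\<lambda>\<omega>. 1 / g + exp (- t * T \<omega>) * (1 / (t - g))"])
      (use intt bound in \<open>auto intro!: AE_I2 intro: order_trans[OF _ abs_ge_self]\<close>)
  \<comment> \<open>The tangent at \<open>g\<close> lies below the transform at \<open>t\<close>,
    which is smaller than at \<open>g\<close>; hence the slope at \<open>g\<close> is
    negative.\<close>
  have "(\<integral>\<omega>. exp (- g * T \<omega>) - (t - g) * (exp (- g * T \<omega>) * T \<omega>) \<partial>M) \<le> ?p t"
    using ints[OF g(1)] intT intt exp_neg_tangent by (intro integral_mono) auto
  then have "exp (- a) - (t - g) * (\<integral>\<omega>. exp (- g * T \<omega>) * T \<omega> \<partial>M) \<le> ?p t"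
    using ints[OF g(1)] intT g(2) by simp
  with pt have "0 < (t - g) * (\<integral>\<omega>. exp (- g * T \<omega>) * T \<omega> \<partial>M)" by linarith
  then have "(\<integral>\<omega>. exp (- g * T \<omega>) * T \<omega> \<partial>M) > 0" using gt by (simp add: zero_less_mult_iff)
  with g0 L least intT show ?thesis by blast
qed

text \<open>The given point is itself the minimal root: to its left the tangent, having negative
  slope, already exceeds \<open>exp (- a)\<close>.\<close>

lemma exponent_exists_boundary:
  assumes a: "a > 0" and g: "g \<ge> 0" "laplace M T g = ennreal (exp (- a))"
    and pos: "(\<integral>\<omega>. exp (- g * T \<omega>) * T \<omega> \<partial>M) > 0"
  shows "\<exists>\<gamma>>0. laplace M T \<gamma> = ennreal (exp (- a)) \<and>
           (\<forall>t>0. laplace M T t = ennreal (exp (- a)) \<longrightarrow> \<gamma> \<le> t) \<and>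
           integrable M (\<lambda>\<omega>. exp (- \<gamma> * T \<omega>) * T \<omega>) \<and> (\<integral>\<omega>. exp (- \<gamma> * T \<omega>) * T \<omega> \<partial>M) > 0"
proof -
  have "g \<noteq> 0" using laplace_eqD(2)[OF g(2)] a prob_space by auto
  then have g0: "g > 0" using g by simp
  \<comment> \<open>A function that is not integrable has integral 0 by convention, so positivity of
    the integral includes integrability.\<close>
  have intT: "integrable M (\<lambda>\<omega>. exp (- g * T \<omega>) * T \<omega>)"
    using pos not_integrable_integral_eq by fastforce
  have "g \<le> t" if t: "t > 0" "laplace M T t = ennreal (exp (- a))" for t
  proof (rule ccontr)
    assume "\<not> g \<le> t"
    note T1 = laplace_eqD[OF t(2)] and G1 = laplace_eqD[OF g(2)]
    have "(\<integral>\<omega>. exp (- g * T \<omega>) - (t - g) * (exp (- g * T \<omega>) * T \<omega>) \<partial>M) \<le> (\<integral>\<omega>. exp (- t * T \<omega>) \<partial>M)"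
      using G1 intT T1 exp_neg_tangent by (intro integral_mono) auto
    then have "0 \<le> (t - g) * (\<integral>\<omega>. exp (- g * T \<omega>) * T \<omega> \<partial>M)"
      using G1 T1 intT by simp
    with pos \<open>\<not> g \<le> t\<close> show False by (simp add: zero_le_mult_iff)
  qed
  with g0 g intT pos show ?thesis by blast
qed

lemma exponent_exists:
  assumes a: "a > 0"
    and R: "ereal a < laplace_R M T \<or>
         (ereal a = laplace_R M T \<and>
          (\<exists>g\<ge>0. laplace M T g = laplace_inf M T \<and> (\<integral>\<omega>. exp (- g * T \<omega>) * T \<omega> \<partial>M) > 0))"
  shows "\<exists>\<gamma>>0. laplace M T \<gamma> = ennreal (exp (- a)) \<and>
           (\<forall>t>0. laplace M T t = ennreal (exp (- a)) \<longrightarrow> \<gamma> \<le> t) \<and>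
           integrable M (\<lambda>\<omega>. exp (- \<gamma> * T \<omega>) * T \<omega>) \<and> (\<integral>\<omega>. exp (- \<gamma> * T \<omega>) * T \<omega> \<partial>M) > 0"
proof -
  have "laplace_inf M T \<le> laplace M T 0" unfolding laplace_inf_def by (rule INF_lower) simp
  then have fin: "laplace_inf M T < \<infinity>" by (simp add: laplace_0 less_le_trans le_less_trans)
  then obtain r where r: "laplace_inf M T = ennreal r" "r \<ge> 0"
    by (cases "laplace_inf M T") auto
  from R show ?thesis
  proof (elim disjE conjE exE)
    assume lt: "ereal a < laplace_R M T"
    have "laplace_inf M T < ennreal (exp (- a))"
    proof (cases "r = 0")
      case False
      then have "a < - ln r" using lt r by (simp add: laplace_R_def)
      then have "r < exp (- a)" using False r by (smt (verit) exp_less_cancel_iff exp_ln)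
      then show ?thesis using r by (simp add: ennreal_less_iff)
    qed (use r in simp)
    then obtain t where "t \<ge> 0" "laplace M T t < ennreal (exp (- a))"
      unfolding laplace_inf_def INF_less_iff by auto
    from exponent_exists_interior[OF a this] show ?thesis .
  next
    fix g assume eq: "ereal a = laplace_R M T" and g: "g \<ge> 0" "laplace M T g = laplace_inf M T"
      and pos: "(\<integral>\<omega>. exp (- g * T \<omega>) * T \<omega> \<partial>M) > 0"
    have "r \<noteq> 0" "a = - ln r" using eq r by (auto simp: laplace_R_def split: if_splits)
    then have "r = exp (- a)" using r by simp
    with exponent_exists_boundary[OF a g(1) _ pos] g(2) r show ?thesis by simp
  qed
qed

end
end

section \<open>Exponential tilting\<close>

lemma (in prob_space) distr_random_walk:
  assumes rw: "zero_delayed_random_walk M T S"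
  shows "distr M borel (S n) = conv_power (distr M borel T) n"
    and "S n \<in> borel_measurable M"
proof -
  obtain X where X: "indep_vars (\<lambda>_. borel) X UNIV" "\<And>i. distr M borel (X i) = distr M borel T"
    "\<And>n \<omega>. \<omega> \<in> space M \<Longrightarrow> S n \<omega> = (\<Sum>i<n. X i \<omega>)"
    using rw unfolding zero_delayed_random_walk_def by blast
  have [measurable]: "X i \<in> borel_measurable M" for i using X(1) by (auto simp: indep_vars_def)
  have "S n \<in> borel_measurable M \<longleftrightarrow> (\<lambda>\<omega>. \<Sum>i<n. X i \<omega>) \<in> borel_measurable M"
    by (rule measurable_cong) (rule X(3))
  then show "S n \<in> borel_measurable M" by simp
  have "distr M borel (\<lambda>\<omega>. \<Sum>i<n. X i \<omega>) = conv_power (distr M borel T) n"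
  proof (induction n)
    case 0
    show ?case by simp
  next
    case (Suc n)
    have ind: "indep_var borel (X n) borel (\<lambda>\<omega>. \<Sum>i<n. X i \<omega>)"
      by (rule indep_vars_sum) (auto intro: indep_vars_subset[OF X(1)])
    have "distr M borel (\<lambda>\<omega>. X n \<omega> + (\<Sum>i<n. X i \<omega>))
        = convolution (distr M borel (X n)) (distr M borel (\<lambda>\<omega>. \<Sum>i<n. X i \<omega>))"
      by (rule sum_indep_random_variable[OF ind]) auto
    then show ?case by (simp add: X(2) Suc add.commute)
  qed
  moreover have "distr M borel (S n) = distr M borel (\<lambda>\<omega>. \<Sum>i<n. X i \<omega>)"
    by (rule distr_cong) (auto simp: X(3))
  ultimately show "distr M borel (S n) = conv_power (distr M borel T) n" by simp
qed

definition tilt :: "real measure \<Rightarrow> real \<Rightarrow> real \<Rightarrow> real measure" where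
  "tilt N a g = density N (\<lambda>t. ennreal (exp (a - g * t)))"

text \<open>The density is multiplicative over the steps, so tilting each step weights the law of
  the sum by a function of the sum alone. Nonnegative integrals spare integrability
  conditions.\<close>

lemma nn_integral_conv_power_tilt:
  assumes N: "real_distribution N" and F: "real_distribution (tilt N a g)"
    and [measurable]: "f \<in> borel_measurable borel"
  shows "(\<integral>\<^sup>+s. f s \<partial>conv_power (tilt N a g) n)
    = (\<integral>\<^sup>+s. ennreal (exp (a * real n - g * s)) * f s \<partial>conv_power N n)"
  using assms(3)
proof (induction n arbitrary: f)
  case 0
  then show ?case by (simp add: nn_integral_return)
next
  case (Suc n)
  note [measurable] = Suc.prems
  interpret N: real_distribution N by (rule N)
  interpret F: real_distribution "tilt N a g" by (rule F)
  interpret Nn: real_distribution "conv_power N n" by (rule N.real_distribution_conv_power)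
  interpret Fn: real_distribution "conv_power (tilt N a g) n" by (rule F.real_distribution_conv_power)
  have "(\<integral>\<^sup>+s. f s \<partial>conv_power (tilt N a g) (Suc n))
      = (\<integral>\<^sup>+t. \<integral>\<^sup>+s. f (t + s) \<partial>conv_power (tilt N a g) n \<partial>tilt N a g)"
    unfolding conv_power.simps
    by (rule nn_integral_convolution) (auto intro: F.finite_measure_axioms Fn.finite_measure_axioms)
  also have "\<dots> = (\<integral>\<^sup>+t. \<integral>\<^sup>+s. ennreal (exp (a * real n - g * s)) * f (t + s) \<partial>conv_power N n \<partial>tilt N a g)"
    by (intro nn_integral_cong Suc.IH) simp
  also have "\<dots> = (\<integral>\<^sup>+t. ennreal (exp (a - g * t)) *
      (\<integral>\<^sup>+s. ennreal (exp (a * real n - g * s)) * f (t + s) \<partial>conv_power N n) \<partial>N)"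
    unfolding tilt_def by (rule nn_integral_density) measurable
  also have "\<dots> = (\<integral>\<^sup>+t. \<integral>\<^sup>+s. ennreal (exp (a * real (Suc n) - g * (t + s))) * f (t + s) \<partial>conv_power N n \<partial>N)"
  proof (rule nn_integral_cong)
    fix t
    have "ennreal (exp (a - g * t)) * (ennreal (exp (a * real n - g * s)) * f (t + s))
        = ennreal (exp (a * real (Suc n) - g * (t + s))) * f (t + s)" for s
    proof -
      have "exp (a * real (Suc n) - g * (t + s)) = exp (a - g * t) * exp (a * real n - g * s)"
        unfolding exp_add[symmetric] by (rule arg_cong[where f=exp]) (simp add: algebra_simps)
      then show ?thesis by (simp add: ennreal_mult mult.assoc)
    qed
    then show "ennreal (exp (a - g * t)) * (\<integral>\<^sup>+s. ennreal (exp (a * real n - g * s)) * f (t + s) \<partial>conv_power N n)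
        = (\<integral>\<^sup>+s. ennreal (exp (a * real (Suc n) - g * (t + s))) * f (t + s) \<partial>conv_power N n)"
      by (subst nn_integral_cmult[symmetric]) simp_all
  qed
  also have "\<dots> = (\<integral>\<^sup>+s. ennreal (exp (a * real (Suc n) - g * s)) * f s \<partial>conv_power N (Suc n))"
    unfolding conv_power.simps
    by (rule nn_integral_convolution[symmetric]) (auto intro: N.finite_measure_axioms Nn.finite_measure_axioms)
  finally show ?case .
qed

section \<open>Transfer from the tilted walk to the original one\<close>

locale tilted_walk = prob_space M for M :: "'a measure" +
  fixes T :: "'a \<Rightarrow> real" and S :: "nat \<Rightarrow> 'a \<Rightarrow> real" and a g :: real
  assumes T_measurable [measurable]: "T \<in> borel_measurable M"
    and walk: "zero_delayed_random_walk M T S"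
    and g_pos: "g > 0"
    and exponent: "laplace M T g = ennreal (exp (- a))"
    and int_T: "integrable M (\<lambda>\<omega>. exp (- g * T \<omega>) * T \<omega>)"
    and mean_T: "(\<integral>\<omega>. exp (- g * T \<omega>) * T \<omega> \<partial>M) > 0"
begin

abbreviation "law \<equiv> distr M borel T"
abbreviation "F \<equiv> tilt law a g"

lemma law: "real_distribution law" by simp

lemma tilted: "real_distribution F"
proof -
  have "emeasure F (space F) = (\<integral>\<^sup>+\<omega>. ennreal (exp (a - g * T \<omega>)) \<partial>M)"
    unfolding tilt_def by (simp add: emeasure_density nn_integral_distr)
  also have "\<dots> = (\<integral>\<^sup>+\<omega>. ennreal (exp a) * ennreal (exp (- g * T \<omega>)) \<partial>M)"
    by (simp add: ennreal_mult[symmetric] exp_add[symmetric])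
  also have "\<dots> = ennreal (exp a) * laplace M T g"
    unfolding laplace_def by (rule nn_integral_cmult) simp
  also have "\<dots> = 1" by (simp add: exponent ennreal_mult[symmetric] exp_add[symmetric])
  finally have "prob_space F" by (rule prob_spaceI)
  then show ?thesis by (simp add: real_distribution_def real_distribution_axioms_def tilt_def)
qed

lemma integrable_F: "integrable F (\<lambda>t. t)"
  and mean_F: "(\<integral>t. t \<partial>F) = exp a * (\<integral>\<omega>. exp (- g * T \<omega>) * T \<omega> \<partial>M)"
proof -
  have eq: "exp (a - g * t) * t = exp a * (exp (- g * t) * t)" for t
  proof -
    have "exp (a - g * t) = exp a * exp (- g * t)" by (simp add: exp_add[symmetric])
    then show ?thesis by simp
  qed
  have "integrable law (\<lambda>t. exp (a - g * t) * t)"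
    unfolding eq using int_T by (simp add: integrable_distr_eq)
  then show "integrable F (\<lambda>t. t)"
    unfolding tilt_def by (subst integrable_density) auto
  show "(\<integral>t. t \<partial>F) = exp a * (\<integral>\<omega>. exp (- g * T \<omega>) * T \<omega> \<partial>M)"
    unfolding tilt_def by (subst integral_density) (auto simp: integral_distr eq)
qed

sublocale D: drift_walk F g
  using tilted integrable_F mean_F mean_T g_pos
  by (auto simp: drift_walk_def drift_walk_axioms_def)

text \<open>A strictly positive density preserves null sets; hence the tilted law has the same span,
  or is likewise non-arithmetic.\<close>

lemma measure_F_eq_1:
  assumes [measurable]: "B \<in> sets borel"
  shows "measure F B = 1 \<longleftrightarrow> measure M {\<omega> \<in> space M. T \<omega> \<in> B} = 1"
proof -
  have "measure F B = 1 \<longleftrightarrow> (AE t in F. t \<in> B)" by (rule D.prob_eq_1) simp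
  also have "\<dots> \<longleftrightarrow> (AE t in law. t \<in> B)"
    unfolding tilt_def by (subst AE_density) simp_all
  also have "\<dots> \<longleftrightarrow> (AE \<omega> in M. T \<omega> \<in> B)" by (subst AE_distr_iff) auto
  also have "\<dots> \<longleftrightarrow> (AE \<omega> in M. \<omega> \<in> {\<omega> \<in> space M. T \<omega> \<in> B})" by (rule AE_cong) simp
  also have "\<dots> \<longleftrightarrow> measure M {\<omega> \<in> space M. T \<omega> \<in> B} = 1" by (rule prob_eq_1[symmetric]) simp
  finally show ?thesis .
qed

text \<open>The factor \<open>exp (- g * s)\<close> of the change of measure cancels against the
  kernel at \<open>x - s\<close>, leaving the indicator of \<open>s \<le> x\<close>.\<close>

lemma kernel_mean_eq: "exp (g * x) * D.kernel_mean (expo g) n x = exp (a * real n) * measure M {\<omega> \<in> space M. S n \<omega> \<le> x}"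
proof -
  interpret L: real_distribution law by (rule law)
  interpret Ln: real_distribution "conv_power law n" by (rule L.real_distribution_conv_power)
  note [measurable] = kernel_measurable(1)
  have "ennreal (D.kernel_mean (expo g) n x) = (\<integral>\<^sup>+s. ennreal (expo g (x - s)) \<partial>conv_power F n)"
    unfolding D.kernel_mean_def
    by (rule nn_integral_eq_integral[symmetric])
      (use D.integrable_kernel[OF D.expo_facts] D.expo_facts in auto)
  also have "\<dots> = (\<integral>\<^sup>+s. ennreal (exp (a * real n - g * s)) * ennreal (expo g (x - s)) \<partial>conv_power law n)"
    by (rule nn_integral_conv_power_tilt[OF law tilted]) simp
  also have "\<dots> = (\<integral>\<^sup>+s. ennreal (exp (a * real n - g * x)) * indicator {..x} s \<partial>conv_power law n)"
    by (intro nn_integral_cong)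
      (auto simp: expo_def indicator_def ennreal_mult[symmetric] exp_add[symmetric] algebra_simps)
  also have "\<dots> = ennreal (exp (a * real n - g * x)) * emeasure (conv_power law n) {..x}"
    by (subst nn_integral_cmult_indicator) auto
  also have "\<dots> = ennreal (exp (a * real n - g * x) * measure (conv_power law n) {..x})"
    by (simp add: Ln.emeasure_eq_measure ennreal_mult)
  finally have "D.kernel_mean (expo g) n x = exp (a * real n - g * x) * measure (conv_power law n) {..x}"
    using D.kernel_mean_nonneg[OF D.expo_facts] by (subst (asm) ennreal_inj) auto
  moreover have "measure (conv_power law n) {..x} = measure M {\<omega> \<in> space M. S n \<omega> \<le> x}"
    unfolding distr_random_walk(1)[OF walk, symmetric]
    using distr_random_walk(2)[OF walk]
    by (subst measure_distr) (auto intro!: arg_cong[where f="measure M"])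
  ultimately show ?thesis by (simp add: exp_diff)
qed

text \<open>Summability of the kernel means makes the series finite, so passing to reals loses
  nothing.\<close>

lemma renewal_V_eq: "enn2real (renewal_V M S a x) = exp (g * x) * D.Q x"
proof -
  have "renewal_V M S a x = (\<Sum>n. ennreal (exp (g * x) * D.kernel_mean (expo g) n x))"
    by (simp add: renewal_V_def kernel_mean_eq)
  also have "\<dots> = ennreal (\<Sum>n. exp (g * x) * D.kernel_mean (expo g) n x)"
    using D.kernel_mean_nonneg[OF D.expo_facts] by (intro suminf_ennreal2 summable_mult D.summable_A_expo) auto
  also have "(\<Sum>n. exp (g * x) * D.kernel_mean (expo g) n x) = exp (g * x) * D.Q x"
    unfolding D.Q_def by (rule suminf_mult[OF D.summable_A_expo])
  finally show ?thesis
    using suminf_nonneg[OF D.summable_A_expo D.kernel_mean_nonneg[OF D.expo_facts]] by (simp add: D.Q_def)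
qed

lemma lattice_borel: "lattice d \<in> sets borel" using closed_lattice by auto

abbreviation "m \<equiv> \<integral>\<omega>. exp (- g * T \<omega>) * T \<omega> \<partial>M"

lemma V_non_arithmetic:
  assumes "non_arithmetic M T"
  shows "(\<lambda>x. enn2real (renewal_V M S a x)) \<sim>[at_top] (\<lambda>x. exp (- a) / (g * m) * exp (g * x))"
proof (rule asymp_equivI')
  have "measure F (lattice d) < 1" if "d > 0" for d
    using assms that measure_F_eq_1[OF lattice_borel, of d] D.prob_le_1[of "lattice d"]
    unfolding non_arithmetic_def by (auto simp: less_le)
  then have "(D.Q \<longlongrightarrow> 1 / (g * (exp a * m))) at_top"
    using D.Q_limit_non_arithmetic mean_F by simp
  then have "((\<lambda>x. D.Q x / (exp (- a) / (g * m))) \<longlongrightarrow> 1 / (g * (exp a * m)) / (exp (- a) / (g * m))) at_top"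
    using g_pos mean_T by (intro tendsto_intros) auto
  also have "1 / (g * (exp a * m)) / (exp (- a) / (g * m)) = 1"
  proof -
    have "1 / (g * (x * y)) / (inverse x / (g * y)) = 1" if "x > 0" "y > 0" for x y :: real
      using that g_pos by (simp add: field_simps)
    from this[OF exp_gt_zero mean_T] show ?thesis unfolding exp_minus[of a] .
  qed
  finally show "((\<lambda>x. enn2real (renewal_V M S a x) / (exp (- a) / (g * m) * exp (g * x))) \<longlongrightarrow> 1) at_top"
    by (simp add: renewal_V_eq)
qed

lemma V_arithmetic:
  assumes ar: "arithmetic_with_span M T d"
  shows "(\<lambda>n::nat. enn2real (renewal_V M S a (d * real n))) \<sim>[at_top]
      (\<lambda>n. d * exp (- a) / ((1 - exp (- d * g)) * m) * exp (g * d * real n))" (is ?th1)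
    and "(\<lambda>n::nat. enn2real (renewal_V M S a (d * real n)) - enn2real (renewal_V M S a (d * (real n - 1)))) \<sim>[at_top]
      (\<lambda>n. d * exp (- a) / m * exp (g * d * real n))" (is ?th2)
proof -
  have d: "d > 0" using ar by (simp add: arithmetic_with_span_def)
  define q where "q = 1 - exp (- d * g)"
  have q: "q > 0" using d g_pos by (simp add: q_def)
  define c where "c = d * exp (- a) / (q * m)"
  have c: "c > 0" using d q mean_T by (simp add: c_def)
  have "(\<lambda>n. D.Q (d * real n)) \<longlonglongrightarrow> d / ((1 - exp (- d * g)) * (\<integral>t. t \<partial>F))"
    by (rule D.Q_limit_arithmetic)
      (use ar measure_F_eq_1[OF lattice_borel] in \<open>auto simp: arithmetic_with_span_def\<close>)
  also have "d / ((1 - exp (- d * g)) * (\<integral>t. t \<partial>F)) = c"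
    unfolding mean_F c_def q_def by (simp add: exp_minus divide_inverse mult_ac)
  finally have Q: "(\<lambda>n. D.Q (d * real n)) \<longlonglongrightarrow> c" .
  have "(\<lambda>n. D.Q (d * real n) / c) \<longlonglongrightarrow> c / c" using c Q by (intro tendsto_intros) auto
  then have "(\<lambda>n. enn2real (renewal_V M S a (d * real n)) / (c * exp (g * d * real n))) \<longlonglongrightarrow> 1"
    using c by (simp add: renewal_V_eq mult.assoc)
  then show ?th1 unfolding c_def q_def by (rule asymp_equivI')
  \<comment> \<open>The subtraction is in the reals, so index 0 refers to the point
    \<open>- d\<close>; a single index does not affect the limit.\<close>
  have "(\<lambda>n. D.Q (d * (real (Suc n) - 1))) \<longlonglongrightarrow> c" using Q by simp
  then have "(\<lambda>n. D.Q (d * (real n - 1))) \<longlonglongrightarrow> c" by (rule LIMSEQ_imp_Suc)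
  with Q have "(\<lambda>n. (D.Q (d * real n) - exp (- d * g) * D.Q (d * (real n - 1))) / (c * q))
      \<longlonglongrightarrow> (c - exp (- d * g) * c) / (c * q)"
    using c q by (intro tendsto_intros) auto
  also have "(c - exp (- d * g) * c) / (c * q) = 1"
  proof -
    \<comment> \<open>One span back costs the factor \<open>exp (- d * g)\<close>, so the difference
      carries the factor \<open>q\<close>, which cancels the denominator in
      \<open>c\<close>.\<close>
    have "c - exp (- d * g) * c = c * q" by (simp add: q_def algebra_simps)
    then show ?thesis using c q by simp
  qed
  also have "(\<lambda>n. (D.Q (d * real n) - exp (- d * g) * D.Q (d * (real n - 1))) / (c * q))
      = (\<lambda>n. (enn2real (renewal_V M S a (d * real n)) - enn2real (renewal_V M S a (d * (real n - 1))))
             / (c * q * exp (g * d * real n)))"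
  proof
    fix n
    have "exp (g * (d * (real n - 1))) = exp (g * d * real n) * exp (- d * g)"
      by (simp add: exp_add[symmetric] algebra_simps)
    then have "enn2real (renewal_V M S a (d * real n)) - enn2real (renewal_V M S a (d * (real n - 1)))
        = (D.Q (d * real n) - exp (- d * g) * D.Q (d * (real n - 1))) * exp (g * d * real n)"
      by (simp add: renewal_V_eq algebra_simps)
    then show "(D.Q (d * real n) - exp (- d * g) * D.Q (d * (real n - 1))) / (c * q)
        = (enn2real (renewal_V M S a (d * real n)) - enn2real (renewal_V M S a (d * (real n - 1))))
             / (c * q * exp (g * d * real n))"
      by simp
  qed
  also have "c * q = d * exp (- a) / m" using q by (simp add: c_def)
  finally show ?th2 by (rule asymp_equivI')
qed

end

theorem theorem2p2:
  fixes M :: "'a measure" and T :: "'a \<Rightarrow> real" and S :: "nat \<Rightarrow> 'a \<Rightarrow> real" and a :: real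
  defines "\<psi> \<equiv> laplace M T"
    and "\<psi>' \<equiv> laplace_left_deriv M T"
    and "V \<equiv> (\<lambda>x. enn2real (renewal_V M S a x))"
  assumes "prob_space M"
    and "T \<in> borel_measurable M"
    and "measure M {\<omega>\<in>space M. T \<omega> = 0} \<noteq> 1"
    and "zero_delayed_random_walk M T S"
    and "a > 0"
    and "ereal a < laplace_R M T \<or>
         (ereal a = laplace_R M T \<and>
          (\<exists>\<gamma>\<^sub>0\<ge>0. \<psi> \<gamma>\<^sub>0 = laplace_inf M T \<and>
             - \<psi>' \<gamma>\<^sub>0 = (\<integral>\<omega>. exp (- \<gamma>\<^sub>0 * T \<omega>) * T \<omega> \<partial>M) \<and>
             (\<integral>\<omega>. exp (- \<gamma>\<^sub>0 * T \<omega>) * T \<omega> \<partial>M) > 0))"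
  shows "\<exists>\<gamma>>0. \<psi> \<gamma> = ennreal (exp (- a)) \<and>
           (\<forall>t>0. \<psi> t = ennreal (exp (- a)) \<longrightarrow> \<gamma> \<le> t) \<and>
           (non_arithmetic M T \<longrightarrow>
              V \<sim>[at_top] (\<lambda>x. exp (- a) / (\<gamma> * (- \<psi>' \<gamma>)) * exp (\<gamma> * x))) \<and>
           (\<forall>d. arithmetic_with_span M T d \<longrightarrow>
              (\<lambda>n::nat. V (d * real n)) \<sim>[at_top]
                (\<lambda>n. d * exp (- a) / ((1 - exp (- d * \<gamma>)) * (- \<psi>' \<gamma>)) * exp (\<gamma> * d * real n)) \<and>
              (\<lambda>n::nat. V (d * real n) - V (d * (real n - 1))) \<sim>[at_top]
                (\<lambda>n. d * exp (- a) / (- \<psi>' \<gamma>) * exp (\<gamma> * d * real n)))"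
proof -
  interpret prob_space M by fact
  obtain g where g: "g > 0" "laplace M T g = ennreal (exp (- a))"
      "\<forall>t>0. laplace M T t = ennreal (exp (- a)) \<longrightarrow> g \<le> t"
      "integrable M (\<lambda>\<omega>. exp (- g * T \<omega>) * T \<omega>)" "(\<integral>\<omega>. exp (- g * T \<omega>) * T \<omega> \<partial>M) > 0"
    using exponent_exists[OF assms(5) assms(8)] assms(9) unfolding \<psi>_def by blast
  interpret W: tilted_walk M T S a g
    by unfold_locales (use assms g in auto)
  have "laplace_left_deriv M T g = - W.m"
    using laplace_left_deriv_eq[OF assms(5) g(1) laplace_eqD(1)[OF assms(5) g(2)] g(4)] by simp
  then have deriv: "- laplace_left_deriv M T g = W.m" by simp
  show ?thesis
    unfolding \<psi>_def \<psi>'_def V_def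
    by (rule exI[of _ g], unfold deriv)
      (use g(1-3) W.V_non_arithmetic W.V_arithmetic in blast)
qed

end
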